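(* Let $W$ be a Coxeter group with simple reflections indexed by $I$ and braid relations indexed by $J$, and let $J_0\subset J$. Then the nil-Hecke algebra $n\mathcal H(W,(2,\dots,2),J_0)$ is a free $\Bbbk$-module with basis $\{\overline{\mathbf s_w}:w\in W(J_0)\}$, where $\{\mathbf s_w:w\in W\}$ is the canonical basis of the nil-Coxeter algebra $NC_W((2,\dots,2))$ and $\overline{\mathbf s_w}$ denotes the image of $\mathbf s_w$ under the natural surjection $NC_W((2,\dots,2))\to n\mathcal H(W,(2,\dots,2),J_0)$.
   Context: $\Bbbk$ is a fixed unital commutative ring. A Coxeter group $W$ has a finite index set $I$ of simple reflections $s_i$ and a Coxeter matrix $(m_{ij})_{i,j\in I}$ with $m_{ii}=1$ and $m_{ij}=m_{ji}\in\{2,3,\dots,\infty\}$ for $i\ne j$. Let $J$ be the set of unordered pairs $\{a,b\}\subset I$, $a\neq b$, with $m_{ab}<\infty$. For $j=\{a,b\}\in J$ let $\mathbf v_j=\mathbf s_a\mathbf s_b\mathbf s_a\cdots$ and $\mathbf w_j=\mathbf s_b\mathbf s_a\mathbf s_b\cdots$ be the two alternating words with $m_{ab}$ letters each (the two sides of the braid relation for $j$). For $J_0\subset J$ and $\mathbf d=(d_i)_{i\in I}$ with integers $d_i\geqslant 2$, the nil-Hecke algebra $n\mathcal H(W,\mathbf d,J_0)$ is the associative unital $\Bbbk$-algebra generated by $\{\mathbf s_i:i\in I\}$ with relations $$\mathbf s_i^{d_i}=0\ (i\in I),\qquad \mathbf v_j=\mathbf w_j\ (j\in J_0),\qquad \mathbf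 v_j=0=\mathbf w_j\ (j\in J\setminus J_0).$$ The nil-Coxeter algebra is $NC_W((2,\dots,2))=n\mathcal H(W,(2,\dots,2),J)$; it is a free $\Bbbk$-module with canonical basis $\mathbf s_w=\mathbf s_{i_1}\cdots\mathbf s_{i_r}$ for $w\in W$, where $w=s_{i_1}\cdots s_{i_r}$ is any reduced expression. $W(J_0)\subset W$ is the set of all $w\in W$ such that no reduced expression for $w$ (viewed as a word in the generators) contains, as a substring of consecutive letters, any of the words in $\{\mathbf v_j,\mathbf w_j:j\in J\setminus J_0\}$. *)

theory Defs
  imports
    "HOL-Library.Extended_Nat"
    "HOL-Library.Sublist"
    "HOL-Algebra.Module"
    "HOL-Algebra.QuotRing"
begin

section \<open>Words and Coxeter groups\<close>

definition word_prod :: "('a, 'b) monoid_scheme \<Rightarrow> ('i \<Rightarrow> 'a) \<Rightarrow> 'i list \<Rightarrow> 'a" where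
  "word_prod G s ws = foldr (\<lambda>i x. s i \<otimes>\<^bsub>G\<^esub> x) ws \<one>\<^bsub>G\<^esub>"

fun alt_word :: "'i \<Rightarrow> 'i \<Rightarrow> nat \<Rightarrow> 'i list" where
  "alt_word a b 0 = []"
| "alt_word a b (Suc n) = a # alt_word b a n"

definition coxeter_matrix :: "'i set \<Rightarrow> ('i \<Rightarrow> 'i \<Rightarrow> enat) \<Rightarrow> bool" where
  "coxeter_matrix I m \<longleftrightarrow>
     (\<forall>i\<in>I. m i i = 1) \<and>
     (\<forall>i\<in>I. \<forall>j\<in>I. i \<noteq> j \<longrightarrow> m i j = m j i \<and> 2 \<le> m i j)"

definition braid_pairs :: "'i set \<Rightarrow> ('i \<Rightarrow> 'i \<Rightarrow> enat) \<Rightarrow> 'i set set" where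
  "braid_pairs I m = {{a, b} | a b. a \<in> I \<and> b \<in> I \<and> a \<noteq> b \<and> m a b < \<infinity>}"

text \<open>The two sides of the braid relation of \<open>{a, b}\<close> are \<open>braid_word m a b\<close> and
  \<open>braid_word m b a\<close>. Below, conditions on an unordered pair are imposed on both
  orderings of it.\<close>

definition braid_word :: "('i \<Rightarrow> 'i \<Rightarrow> enat) \<Rightarrow> 'i \<Rightarrow> 'i \<Rightarrow> 'i list" where
  "braid_word m a b = alt_word a b (the_enat (m a b))"

text \<open>The group presented by the relations \<open>(s\<^sub>i s\<^sub>j)^(m i j) = 1\<close> for \<open>m i j < \<infinity>\<close>. The case
  \<open>i = j\<close> makes every generator its own inverse, so that words in the generators
  alone, without formal inverses, suffice.\<close>

inductive_set coxeter_cong :: "'i set \<Rightarrow> ('i \<Rightarrow> 'i \<Rightarrow> enat) \<Rightarrow> ('i list \<times> 'i list) set"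
  for I :: "'i set" and m :: "'i \<Rightarrow> 'i \<Rightarrow> enat" where
  rel: "\<lbrakk>i \<in> I; j \<in> I; m i j = enat n\<rbrakk> \<Longrightarrow> (concat (replicate n [i, j]), []) \<in> coxeter_cong I m"
| refl: "u \<in> lists I \<Longrightarrow> (u, u) \<in> coxeter_cong I m"
| sym: "(u, v) \<in> coxeter_cong I m \<Longrightarrow> (v, u) \<in> coxeter_cong I m"
| trans: "\<lbrakk>(u, v) \<in> coxeter_cong I m; (v, w) \<in> coxeter_cong I m\<rbrakk> \<Longrightarrow> (u, w) \<in> coxeter_cong I m"
| append: "\<lbrakk>(u, u') \<in> coxeter_cong I m; (v, v') \<in> coxeter_cong I m\<rbrakk>
    \<Longrightarrow> (u @ v, u' @ v') \<in> coxeter_cong I m"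

definition coxeter_group :: "'i set \<Rightarrow> ('i \<Rightarrow> 'i \<Rightarrow> enat) \<Rightarrow> 'i list set monoid" where
  "coxeter_group I m =
     \<lparr>carrier = lists I // coxeter_cong I m,
      mult = (\<lambda>A B. \<Union>u\<in>A. \<Union>v\<in>B. coxeter_cong I m `` {u @ v}),
      one = coxeter_cong I m `` {[]}\<rparr>"

definition simple_refl :: "'i set \<Rightarrow> ('i \<Rightarrow> 'i \<Rightarrow> enat) \<Rightarrow> 'i \<Rightarrow> 'i list set" where
  "simple_refl I m i = coxeter_cong I m `` {[i]}"

definition expresses :: "'i set \<Rightarrow> ('i \<Rightarrow> 'i \<Rightarrow> enat) \<Rightarrow> 'i list \<Rightarrow> 'i list set \<Rightarrow> bool" where
  "expresses I m ws w \<longleftrightarrow>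
     ws \<in> lists I \<and> word_prod (coxeter_group I m) (simple_refl I m) ws = w"

definition reduced_expr :: "'i set \<Rightarrow> ('i \<Rightarrow> 'i \<Rightarrow> enat) \<Rightarrow> 'i list \<Rightarrow> 'i list set \<Rightarrow> bool" where
  "reduced_expr I m ws w \<longleftrightarrow>
     expresses I m ws w \<and> (\<forall>vs. expresses I m vs w \<longrightarrow> length ws \<le> length vs)"

definition W_sub :: "'i set \<Rightarrow> ('i \<Rightarrow> 'i \<Rightarrow> enat) \<Rightarrow> 'i set set \<Rightarrow> 'i list set set" where
  "W_sub I m J0 = {w \<in> carrier (coxeter_group I m).
     \<forall>ws a b. reduced_expr I m ws w \<longrightarrow> {a, b} \<in> braid_pairs I m - J0
        \<longrightarrow> \<not> sublist (braid_word m a b) ws}"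


section \<open>Nil-Hecke algebras\<close>

text \<open>Noncommutative polynomials: an element is the family of its coefficients, indexed by
  words. The locale \<open>algebra\<close> of the library requires commutative algebras,
  so only its record type is used.\<close>

definition free_algebra ::
  "('k, 'c) ring_scheme \<Rightarrow> 'i set \<Rightarrow> ('k, 'i list \<Rightarrow> 'k) module" where
  "free_algebra K I =
     \<lparr>carrier = {f. (\<forall>u. f u \<in> carrier K) \<and> (\<forall>u. u \<notin> lists I \<longrightarrow> f u = \<zero>\<^bsub>K\<^esub>)
                   \<and> finite {u. f u \<noteq> \<zero>\<^bsub>K\<^esub>}},
      mult = (\<lambda>f g u. \<Oplus>\<^bsub>K\<^esub>n\<in>{..length u}. f (take n u) \<otimes>\<^bsub>K\<^esub> g (drop n u)),
      one = (\<lambda>u. if u = [] then \<one>\<^bsub>K\<^esub> else \<zero>\<^bsub>K\<^esub>),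
      zero = (\<lambda>u. \<zero>\<^bsub>K\<^esub>),
      add = (\<lambda>f g u. f u \<oplus>\<^bsub>K\<^esub> g u),
      smult = (\<lambda>a f u. a \<otimes>\<^bsub>K\<^esub> f u)\<rparr>"

definition free_gen :: "('k, 'c) ring_scheme \<Rightarrow> 'i \<Rightarrow> 'i list \<Rightarrow> 'k" where
  "free_gen K i = (\<lambda>u. if u = [i] then \<one>\<^bsub>K\<^esub> else \<zero>\<^bsub>K\<^esub>)"

definition quot_algebra ::
  "('k, 'a, 'c) module_scheme \<Rightarrow> 'a set \<Rightarrow> ('k, 'a set) module" where
  "quot_algebra A N =
     ring.extend (A Quot N) (module.fields (\<lambda>a X. \<Union>x\<in>X. N +>\<^bsub>A\<^esub> (a \<odot>\<^bsub>A\<^esub> x)))"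

definition nil_hecke_relators ::
  "('k, 'c) ring_scheme \<Rightarrow> 'i set \<Rightarrow> ('i \<Rightarrow> 'i \<Rightarrow> enat) \<Rightarrow> ('i \<Rightarrow> nat) \<Rightarrow> 'i set set
     \<Rightarrow> ('i list \<Rightarrow> 'k) set" where
  "nil_hecke_relators K I m d J0 =
    (let F = free_algebra K I; braid = (\<lambda>a b. word_prod F (free_gen K) (braid_word m a b)) in
      {free_gen K i [^]\<^bsub>F\<^esub> d i | i. i \<in> I}
      \<union> {braid a b \<ominus>\<^bsub>F\<^esub> braid b a | a b. {a, b} \<in> J0}
      \<union> {braid a b | a b. {a, b} \<in> braid_pairs I m - J0})"

text \<open>Two-sided: \<open>ideal\<close> of \<open>HOL-Algebra\<close> is two-sided over a noncommutative ring. Scalars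
  act as central elements of the free algebra, so its ideals are submodules.\<close>

definition nil_hecke_ideal ::
  "('k, 'c) ring_scheme \<Rightarrow> 'i set \<Rightarrow> ('i \<Rightarrow> 'i \<Rightarrow> enat) \<Rightarrow> ('i \<Rightarrow> nat) \<Rightarrow> 'i set set
     \<Rightarrow> ('i list \<Rightarrow> 'k) set" where
  "nil_hecke_ideal K I m d J0 = Idl\<^bsub>free_algebra K I\<^esub> (nil_hecke_relators K I m d J0)"

definition nil_hecke ::
  "('k, 'c) ring_scheme \<Rightarrow> 'i set \<Rightarrow> ('i \<Rightarrow> 'i \<Rightarrow> enat) \<Rightarrow> ('i \<Rightarrow> nat) \<Rightarrow> 'i set set
     \<Rightarrow> ('k, ('i list \<Rightarrow> 'k) set) module" where
  "nil_hecke K I m d J0 = quot_algebra (free_algebra K I) (nil_hecke_ideal K I m d J0)"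

definition nil_hecke_gen ::
  "('k, 'c) ring_scheme \<Rightarrow> 'i set \<Rightarrow> ('i \<Rightarrow> 'i \<Rightarrow> enat) \<Rightarrow> ('i \<Rightarrow> nat) \<Rightarrow> 'i set set
     \<Rightarrow> 'i \<Rightarrow> ('i list \<Rightarrow> 'k) set" where
  "nil_hecke_gen K I m d J0 i = nil_hecke_ideal K I m d J0 +>\<^bsub>free_algebra K I\<^esub> free_gen K i"

definition nil_coxeter ::
  "('k, 'c) ring_scheme \<Rightarrow> 'i set \<Rightarrow> ('i \<Rightarrow> 'i \<Rightarrow> enat) \<Rightarrow> ('k, ('i list \<Rightarrow> 'k) set) module" where
  "nil_coxeter K I m = nil_hecke K I m (\<lambda>_. 2) (braid_pairs I m)"

text \<open>That the product is the same for all reduced expressions of \<open>w\<close> is Matsumoto's theorem.\<close>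

definition nil_coxeter_basis ::
  "('k, 'c) ring_scheme \<Rightarrow> 'i set \<Rightarrow> ('i \<Rightarrow> 'i \<Rightarrow> enat) \<Rightarrow> 'i list set \<Rightarrow> ('i list \<Rightarrow> 'k) set" where
  "nil_coxeter_basis K I m w = (THE x. \<forall>ws. reduced_expr I m ws w \<longrightarrow>
     x = word_prod (nil_coxeter K I m) (nil_hecke_gen K I m (\<lambda>_. 2) (braid_pairs I m)) ws)"

text \<open>The natural surjection from the nil-Coxeter algebra sends a coset \<open>f + N\<close> to \<open>f + N0\<close>,
  where \<open>N \<subseteq> N0\<close> are the two defining ideals.\<close>

definition nil_hecke_proj ::
  "('k, 'c) ring_scheme \<Rightarrow> 'i set \<Rightarrow> ('i \<Rightarrow> 'i \<Rightarrow> enat) \<Rightarrow> 'i set set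
     \<Rightarrow> ('i list \<Rightarrow> 'k) set \<Rightarrow> ('i list \<Rightarrow> 'k) set" where
  "nil_hecke_proj K I m J0 X =
     (\<Union>f\<in>X. nil_hecke_ideal K I m (\<lambda>_. 2) J0 +>\<^bsub>free_algebra K I\<^esub> f)"


section \<open>Bases of modules\<close>

text \<open>A basis is an indexed family, so that repetitions are excluded over a nonzero ring.\<close>

definition module_basis ::
  "('k, 'c) ring_scheme \<Rightarrow> ('k, 'a, 'd) module_scheme \<Rightarrow> 'x set \<Rightarrow> ('x \<Rightarrow> 'a) \<Rightarrow> bool" where
  "module_basis K M X b \<longleftrightarrow>
     module K M \<and> b \<in> X \<rightarrow> carrier M \<and>
     (\<forall>v\<in>carrier M. \<exists>Y c. finite Y \<and> Y \<subseteq> X \<and> c \<in> Y \<rightarrow> carrier K \<and>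
        v = (\<Oplus>\<^bsub>M\<^esub>x\<in>Y. c x \<odot>\<^bsub>M\<^esub> b x)) \<and>
     (\<forall>Y c. finite Y \<and> Y \<subseteq> X \<and> c \<in> Y \<rightarrow> carrier K \<and>
        (\<Oplus>\<^bsub>M\<^esub>x\<in>Y. c x \<odot>\<^bsub>M\<^esub> b x) = \<zero>\<^bsub>M\<^esub> \<longrightarrow> (\<forall>x\<in>Y. c x = \<zero>\<^bsub>K\<^esub>))"

end

theory Submission
  imports Defs Complex_Main
begin

text \<open>With all exponents equal to 2, every relation either equates two words or kills a word.
  The ideal generated by these relations is contained in the span of the words that they force
  to be zero and of the differences of words that they identify (\<open>relation_ideal_subset\<close>). Hence
  the quotient is free on the classes of words modulo the braid moves in \<open>J0\<close>, once the classes
  are removed in which some word has a killed word as a factor: the sum of the coefficients over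
  a surviving class is a linear functional that vanishes on the ideal
  (\<open>coeff_sum_binomial_span\<close>), and these functionals separate the classes.

  It remains to match the surviving classes with \<open>W(J0)\<close> (\<open>elem_in_W_sub_iff\<close>). On a surviving
  class no braid move outside \<open>J0\<close> is applicable, so it is a class for all braid moves. No word
  in it contains a square \<open>ii\<close>, hence its words are reduced (\<open>tits_word\<close>), and then they are all
  the reduced expressions of one element (\<open>matsumoto\<close>); this element lies in \<open>W(J0)\<close> because no
  side of a braid relation outside \<open>J0\<close> occurs in them. Conversely, the reduced expressions of
  an element of \<open>W(J0)\<close> contain neither squares nor such sides, so their class survives.

  The theorems of Matsumoto and Tits rest on two properties of the group presented by the
  Coxeter relations. The exchange property (\<open>exchange\<close>) holds because the parity with which a
  given reflection occurs among those attached to a word depends only on the element that the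
  word represents. The second is that \<open>aba\<dots>\<close> and \<open>bab\<dots>\<close> with \<open>k < m a b\<close> letters represent
  different elements (\<open>alt_word_not_cong\<close>). This is shown by letting the group act on real
  functions on the set of generators, by the dual of its geometric representation.\<close>

section \<open>Words up to the Coxeter relations\<close>

locale coxeter_system =
  fixes I :: "'i set" and m :: "'i \<Rightarrow> 'i \<Rightarrow> enat"
  assumes coxeter_matrix: "coxeter_matrix I m"
begin

definition cong :: "'i list \<Rightarrow> 'i list \<Rightarrow> bool" (infix "\<approx>" 50) where
  "u \<approx> v \<longleftrightarrow> (u, v) \<in> coxeter_cong I m"

lemmas cong_rel = coxeter_cong.rel[of _ I _ m, folded cong_def]
lemmas cong_refl = coxeter_cong.refl[of _ I m, folded cong_def]
lemmas cong_sym = coxeter_cong.sym[of _ _ I m, folded cong_def]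
lemmas cong_trans [trans] = coxeter_cong.trans[of _ _ I m, folded cong_def]
lemmas cong_append = coxeter_cong.append[of _ _ I m, folded cong_def]
lemmas cong_induct [consumes 1, case_names rel refl sym trans append] =
  coxeter_cong.induct[of _ _ I m, folded cong_def]

lemma m_diag: "i \<in> I \<Longrightarrow> m i i = 1"
  using coxeter_matrix by (auto simp: coxeter_matrix_def)

lemma m_sym: "i \<in> I \<Longrightarrow> j \<in> I \<Longrightarrow> m i j = m j i"
  using coxeter_matrix by (cases "i = j") (auto simp: coxeter_matrix_def)

lemma m_ge_2: "i \<in> I \<Longrightarrow> j \<in> I \<Longrightarrow> i \<noteq> j \<Longrightarrow> 2 \<le> m i j"
  using coxeter_matrix by (auto simp: coxeter_matrix_def)

lemma cong_in_lists:
  assumes "u \<approx> v"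
  shows "u \<in> lists I" "v \<in> lists I"
proof -
  have "u \<in> lists I \<and> v \<in> lists I"
    using assms by (induction rule: cong_induct) (auto simp: in_lists_conv_set)
  then show "u \<in> lists I" "v \<in> lists I" by auto
qed

lemma cong_equiv: "equiv (lists I) (coxeter_cong I m)"
proof (intro equivI refl_onI symI transI)
  show "coxeter_cong I m \<subseteq> lists I \<times> lists I"
    using cong_in_lists unfolding cong_def by (intro subrelI) blast
qed (use cong_refl cong_sym cong_trans in \<open>unfold cong_def, blast+\<close>)

lemma cong_context:
  "u \<approx> v \<Longrightarrow> x \<in> lists I \<Longrightarrow> y \<in> lists I \<Longrightarrow> x @ u @ y \<approx> x @ v @ y"
  by (intro cong_append cong_refl)

lemma cong_square: "i \<in> I \<Longrightarrow> [i, i] \<approx> []"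
  using cong_rel[of i i 1] m_diag[of i] by (simp add: one_enat_def)

lemma cong_cancel_pair:
  assumes "i \<in> I" "x \<in> lists I" "y \<in> lists I"
  shows "x @ i # i # y \<approx> x @ y"
  using cong_context[OF cong_square, of i x y] assms by simp

lemma cong_append_rev:
  "u \<in> lists I \<Longrightarrow> u @ rev u \<approx> []"
proof (induction u)
  case (Cons a u)
  have "[a] @ (u @ rev u) @ [a] \<approx> [a] @ [] @ [a]"
    using Cons by (intro cong_context) auto
  also have "[a] @ [] @ [a] \<approx> []" using Cons cong_square[of a] by auto
  finally show ?case by simp
qed (auto intro: cong_refl)

lemma cong_rev_append:
  "u \<in> lists I \<Longrightarrow> rev u @ u \<approx> []"
  using cong_append_rev[of "rev u"] by (simp add: in_lists_conv_set)

lemma cong_shift: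
  assumes "u @ x \<approx> y" "u \<in> lists I" "x \<in> lists I"
  shows "x \<approx> rev u @ y"
proof -
  have "x \<approx> (rev u @ u) @ x"
    using assms by (intro cong_append[of "[]", simplified] cong_sym[OF cong_rev_append] cong_refl)
  also have "\<dots> \<approx> rev u @ y"
    using assms cong_append[OF cong_refl assms(1), of "rev u"] by (simp add: in_lists_conv_set)
  finally show ?thesis .
qed

lemma cong_cancel_left:
  assumes "u @ x \<approx> u @ y" shows "x \<approx> y"
proof -
  have l: "u \<in> lists I" "x \<in> lists I" "y \<in> lists I"
    using cong_in_lists[OF assms] by auto
  have "x \<approx> rev u @ u @ y" using cong_shift[OF assms] l by auto
  also have "\<dots> \<approx> [] @ y"
    using cong_append[OF cong_rev_append cong_refl, of u y] l by simp
  finally show ?thesis by simp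
qed

lemma cong_cancel_right:
  assumes "x @ u \<approx> y @ u" shows "x \<approx> y"
proof -
  have l: "u \<in> lists I" "x \<in> lists I" "y \<in> lists I"
    using cong_in_lists[OF assms] by auto
  have r: "x @ u @ rev u \<approx> x" if "x \<in> lists I" for x
    using cong_append[OF cong_refl[of x] cong_append_rev[of u]] that l by simp
  have "x \<approx> x @ u @ rev u" using r l cong_sym by blast
  also have "x @ u @ rev u \<approx> y @ u @ rev u"
    using cong_append[OF assms cong_refl, of "rev u"] l by (simp add: in_lists_conv_set)
  also have "\<dots> \<approx> y" using r l by blast
  finally show ?thesis .
qed

text \<open>Every relator has even length, so the length of a word modulo 2 is an invariant of its
  element.\<close>

lemma cong_even_length: "u \<approx> v \<Longrightarrow> even (length u) = even (length v)"
proof (induction rule: cong_induct)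
  case (rel i j n)
  have "length (concat (replicate n [i, j])) = 2 * n" by (induction n) auto
  then show ?case by simp
qed auto

section \<open>Reduced words\<close>

definition reduced :: "'i list \<Rightarrow> bool" where
  "reduced u \<longleftrightarrow> u \<in> lists I \<and> (\<forall>v. u \<approx> v \<longrightarrow> length u \<le> length v)"

lemma reduced_in_lists: "reduced u \<Longrightarrow> u \<in> lists I"
  by (simp add: reduced_def)

lemma reduced_length_le: "reduced u \<Longrightarrow> u \<approx> v \<Longrightarrow> length u \<le> length v"
  by (simp add: reduced_def)

lemma reduced_if_cong:
  "reduced u \<Longrightarrow> u \<approx> v \<Longrightarrow> length v \<le> length u \<Longrightarrow> reduced v"
  unfolding reduced_def
  by (meson cong_in_lists(2) cong_trans order_trans)

lemma reduced_cong_length: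
  "reduced u \<Longrightarrow> reduced v \<Longrightarrow> u \<approx> v \<Longrightarrow> length u = length v"
  unfolding reduced_def using cong_sym by (meson order_antisym)

lemma reduced_factor:
  assumes "reduced (x @ u @ y)" shows "reduced u"
proof -
  have l: "x \<in> lists I" "u \<in> lists I" "y \<in> lists I"
    using reduced_in_lists[OF assms] by auto
  show ?thesis unfolding reduced_def
  proof (intro conjI allI impI)
    fix v assume "u \<approx> v"
    from reduced_length_le[OF assms cong_context[OF this l(1,3)]]
    show "length u \<le> length v" by simp
  qed (use l in auto)
qed

lemma reduced_no_square: "\<not> reduced (x @ i # i # y)"
proof
  assume r: "reduced (x @ i # i # y)"
  then have "x @ i # i # y \<approx> x @ y"
    using reduced_in_lists[OF r] by (intro cong_cancel_pair) auto
  from reduced_length_le[OF r this] show False by simp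
qed

lemma ex_reduced:
  assumes "u \<in> lists I"
  obtains v where "reduced v" "u \<approx> v" "length v \<le> length u"
proof -
  define v where "v = (ARG_MIN length v. u \<approx> v)"
  have "u \<approx> u" using assms by (rule cong_refl)
  then have v: "u \<approx> v" "\<And>x. u \<approx> x \<Longrightarrow> length v \<le> length x"
    unfolding v_def by (rule arg_min_natI, simp add: arg_min_nat_le)
  have "reduced v"
    unfolding reduced_def using v cong_in_lists(2)[OF v(1)] cong_trans[OF v(1)] by auto
  with v \<open>u \<approx> u\<close> that show ?thesis by blast
qed

section \<open>The exchange property\<close>

text \<open>The reflections attached to \<open>s\<^sub>1\<dots>s\<^sub>r\<close> are the elements \<open>s\<^sub>1\<dots>s\<^sub>i\<dots>s\<^sub>1\<close>. The predicate says
  that an odd number of them equals the element of the word \<open>t\<close>. The recursion strips \<open>s\<^sub>1\<close>,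
  which conjugates the remaining reflections by \<open>s\<^sub>1\<close>.\<close>

primrec crossing :: "'i list \<Rightarrow> 'i list \<Rightarrow> bool" where
  "crossing [] t = False"
| "crossing (s # u) t = (([s] \<approx> t) \<noteq> crossing u (s # t @ [s]))"

lemma crossing_append:
  "crossing (u @ v) t = (crossing u t \<noteq> crossing v (rev u @ t @ u))"
  by (induction u arbitrary: t) auto

lemma crossing_cong_right:
  "u \<in> lists I \<Longrightarrow> t \<approx> t' \<Longrightarrow> crossing u t = crossing u t'"
proof (induction u arbitrary: t t')
  case (Cons s u)
  have "[s] @ t @ [s] \<approx> [s] @ t' @ [s]" using Cons by (intro cong_context) auto
  then have "crossing u (s # t @ [s]) = crossing u (s # t' @ [s])" using Cons by simp
  moreover have "[s] \<approx> t \<longleftrightarrow> [s] \<approx> t'" using Cons.prems cong_sym cong_trans by metis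
  ultimately show ?case by simp
qed simp

lemma cong_conjugate:
  assumes "s \<in> I" "t \<in> lists I" "u \<in> lists I"
  shows "u \<approx> s # t @ [s] \<longleftrightarrow> s # u @ [s] \<approx> t"
proof
  have ss: "s # (s # x @ [s]) @ [s] \<approx> x" if "x \<in> lists I" for x
  proof -
    have "[] @ s # s # (x @ [s, s]) \<approx> [] @ (x @ [s, s])"
      using that assms by (intro cong_cancel_pair) auto
    also have "\<dots> \<approx> x" using cong_cancel_pair[of s x "[]"] that assms by simp
    finally show ?thesis by simp
  qed
  {
    assume "u \<approx> s # t @ [s]"
    then have "s # u @ [s] \<approx> s # (s # t @ [s]) @ [s]"
      using cong_context[of u "s # t @ [s]" "[s]" "[s]"] assms by simp
    then show "s # u @ [s] \<approx> t" using ss assms cong_trans by metis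
  next
    assume "s # u @ [s] \<approx> t"
    then have "s # (s # u @ [s]) @ [s] \<approx> s # t @ [s]"
      using cong_context[of "s # u @ [s]" t "[s]" "[s]"] assms by simp
    then show "u \<approx> s # t @ [s]" using ss[of u] assms cong_trans cong_sym by metis
  }
qed

lemma length_alt_word [simp]: "length (alt_word a b n) = n"
  by (induction n arbitrary: a b) auto

lemma alt_word_in_lists: "a \<in> I \<Longrightarrow> b \<in> I \<Longrightarrow> alt_word a b n \<in> lists I"
  by (induction n arbitrary: a b) auto

lemma alt_word_snoc:
  "alt_word a b (Suc n) = alt_word a b n @ [if even n then a else b]"
  by (induction n arbitrary: a b) auto

lemma alt_word_add:
  "alt_word a b (k + n) = alt_word a b k @ (if even k then alt_word a b n else alt_word b a n)"
  by (induction k arbitrary: a b) auto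

lemma alt_word_even: "alt_word a b (2 * n) = concat (replicate n [a, b])"
  by (induction n) auto

text \<open>The reflections attached to \<open>aba\<dots>\<close> are the alternating words of odd length that begin with
  \<open>a\<close>.\<close>

lemma crossing_alt_word:
  assumes "a \<in> I" "b \<in> I" "t \<in> lists I"
  shows "crossing (alt_word a b k) t =
    odd (\<Sum>i<k. of_bool (alt_word a b (2 * i + 1) \<approx> t) :: nat)"
  using assms
proof (induction k arbitrary: a b t)
  case (Suc k)
  have *: "alt_word b a (2 * i + 1) \<approx> a # t @ [a] \<longleftrightarrow> alt_word a b (2 * Suc i + 1) \<approx> t" for i
  proof -
    have "a # alt_word b a (2 * i + 1) @ [a] = alt_word a b (2 * Suc i + 1)"
      using alt_word_snoc[of a b "2 * i + 2"] by simp
    then show ?thesis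
      using cong_conjugate[of a t "alt_word b a (2 * i + 1)"] Suc.prems
        alt_word_in_lists by metis
  qed
  have "crossing (alt_word b a k) (a # t @ [a]) =
      odd (\<Sum>i<k. of_bool (alt_word a b (2 * Suc i + 1) \<approx> t) :: nat)"
    unfolding *[symmetric] using Suc.prems by (intro Suc.IH) auto
  moreover have "(\<Sum>i<Suc k. of_bool (alt_word a b (2 * i + 1) \<approx> t) :: nat) =
      of_bool ([a] \<approx> t) + (\<Sum>i<k. of_bool (alt_word a b (2 * Suc i + 1) \<approx> t))"
    by (subst sum.lessThan_Suc_shift) simp
  ultimately show ?case by simp
qed simp

text \<open>The odd alternating words of length \<open>2i + 1\<close> and \<open>2(n + i) + 1\<close> differ by the relator
  \<open>(ab)\<^sup>n\<close>, so among the \<open>2n\<close> reflections attached to that relator each one occurs an even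
  number of times.\<close>

lemma crossing_relator:
  assumes "a \<in> I" "b \<in> I" "m a b = enat n" "t \<in> lists I"
  shows "\<not> crossing (concat (replicate n [a, b])) t"
proof -
  let ?f = "\<lambda>i. of_bool (alt_word a b (2 * i + 1) \<approx> t) :: nat"
  have rel: "alt_word a b (2 * n) \<approx> []"
    using cong_rel[of a b n] assms by (simp add: alt_word_even)
  have per: "?f (n + i) = ?f i" for i
  proof -
    have "alt_word a b (2 * n) @ alt_word a b (2 * i + 1) \<approx> [] @ alt_word a b (2 * i + 1)"
      using assms by (intro cong_append rel cong_refl alt_word_in_lists)
    moreover have "alt_word a b (2 * (n + i) + 1) = alt_word a b (2 * n) @ alt_word a b (2 * i + 1)"
      using alt_word_add[of a b "2 * n" "2 * i + 1"] by (simp only: distrib_left add.assoc) simp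
    ultimately have "alt_word a b (2 * (n + i) + 1) \<approx> alt_word a b (2 * i + 1)" by simp
    then have "alt_word a b (2 * (n + i) + 1) \<approx> t \<longleftrightarrow> alt_word a b (2 * i + 1) \<approx> t"
      using cong_sym cong_trans by metis
    then show ?thesis by (simp only:)
  qed
  have "(\<Sum>i<2 * n. ?f i) = (\<Sum>i<n. ?f i) + (\<Sum>i<n. ?f (n + i))"
  proof -
    have "{..<2 * n} = {..<n} \<union> (\<lambda>i. n + i) ` {..<n}"
      by (auto simp: lessThan_atLeast0)
    moreover have "sum ?f ({..<n} \<union> (\<lambda>i. n + i) ` {..<n}) = sum ?f {..<n} + sum ?f ((\<lambda>i. n + i) ` {..<n})"
      by (rule sum.union_disjoint) auto
    moreover have "sum ?f ((\<lambda>i. n + i) ` {..<n}) = (\<Sum>i<n. ?f (n + i))"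
      by (subst sum.reindex) (auto simp: o_def)
    ultimately show ?thesis by metis
  qed
  also have "\<dots> = 2 * (\<Sum>i<n. ?f i)" by (simp only: per)
  finally have "even (\<Sum>i<2 * n. ?f i)" by simp
  then show ?thesis
    using crossing_alt_word[of a b t "2 * n"] assms by (simp only: alt_word_even) simp
qed

text \<open>The parity of a reflection is an invariant of the element: it vanishes on relators by
  \<open>crossing_relator\<close>, and \<open>crossing_append\<close> carries it through concatenation.\<close>

lemma crossing_cong_left:
  "u \<approx> v \<Longrightarrow> t \<in> lists I \<Longrightarrow> crossing u t = crossing v t"
proof (induction arbitrary: t rule: cong_induct)
  case (rel i j n)
  then show ?case using crossing_relator by simp
next
  case (append u u' v v')
  have l: "u \<in> lists I" "u' \<in> lists I" "v \<in> lists I" "v' \<in> lists I"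
    using append cong_in_lists by auto
  have "rev u \<approx> rev u'"
  proof -
    have "rev u @ u' \<approx> rev u @ u"
      using append l by (intro cong_append cong_refl) (auto simp: in_lists_conv_set intro: cong_sym)
    also have "\<dots> \<approx> []" using l by (rule_tac cong_rev_append)
    also have "[] \<approx> rev u' @ u'" using l by (intro cong_sym[OF cong_rev_append])
    finally show ?thesis by (rule cong_cancel_right)
  qed
  then have "rev u @ t @ u \<approx> rev u' @ t @ u'"
    using append by (intro cong_append cong_refl)
  then have "crossing v (rev u @ t @ u) = crossing v (rev u' @ t @ u')"
    using l by (intro crossing_cong_right)
  moreover have "crossing v (rev u' @ t @ u') = crossing v' (rev u' @ t @ u')"
    using append l by (intro append.IH) (auto simp: in_lists_conv_set)
  ultimately show ?case
    using append by (simp add: crossing_append)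
qed auto

text \<open>If \<open>t = s\<^sub>1\<dots>s\<^sub>i\<dots>s\<^sub>1\<close>, then multiplying \<open>s\<^sub>1\<dots>s\<^sub>r\<close> by \<open>t\<close> from the left deletes \<open>s\<^sub>i\<close>.\<close>

lemma crossing_delete:
  assumes "crossing u t" "u \<in> lists I" "t \<in> lists I"
  obtains x i y where "u = x @ i # y" "t @ u \<approx> x @ y"
proof -
  have "\<exists>x i y. u = x @ i # y \<and> t @ u \<approx> x @ y"
    using assms
  proof (induction u arbitrary: t)
    case (Cons s u)
    show ?case
    proof (cases "[s] \<approx> t")
      case True
      have "t @ (s # u) \<approx> [s] @ (s # u)"
        using True Cons.prems by (intro cong_append cong_sym[OF True] cong_refl) auto
      also have "\<dots> \<approx> [] @ u" using cong_cancel_pair[of s "[]" u] Cons.prems by simp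
      finally show ?thesis by (metis append_Nil)
    next
      case False
      with Cons.prems have "crossing u (s # t @ [s])" by simp
      with Cons obtain x i y where xy: "u = x @ i # y" "(s # t @ [s]) @ u \<approx> x @ y"
        by (metis Cons_in_lists_iff append_in_lists_conv lists.Nil)
      have "t @ s # u \<approx> rev [s] @ (x @ y)"
        using xy(2) Cons.prems by (intro cong_shift) auto
      with xy(1) show ?thesis by (intro exI[of _ "s # x"] exI[of _ i] exI[of _ y]) simp
    qed
  qed simp
  with that show thesis by blast
qed

text \<open>It suffices that \<open>s\<close> is among the reflections of \<open>u\<close>. If it were not, it would have odd
  parity in \<open>s # u\<close>, hence in every word \<open>v\<close> for the same element. Deleting a letter of \<open>v\<close>
  would then give a word for \<open>u\<close> that is shorter than \<open>u\<close>.\<close>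

lemma exchange:
  assumes "reduced u" "s \<in> I" "s # u \<approx> v" "length v \<le> length u"
  obtains x i y where "u = x @ i # y" "s # u \<approx> x @ y"
proof -
  have l: "u \<in> lists I" "v \<in> lists I"
    using assms cong_in_lists by (auto simp: reduced_in_lists)
  have "crossing u [s]"
  proof (rule ccontr)
    assume n: "\<not> crossing u [s]"
    have "[s, s, s] \<approx> [s]" using cong_cancel_pair[of s "[]" "[s]"] assms by simp
    then have "\<not> crossing u [s, s, s]" using n crossing_cong_right l by blast
    moreover have "[s] \<approx> [s]" using assms by (intro cong_refl) auto
    ultimately have "crossing (s # u) [s]" by simp
    moreover have "crossing (s # u) [s] = crossing v [s]"
      using assms by (intro crossing_cong_left) auto
    ultimately have "crossing v [s]" by blast
    then obtain x i y where xy: "v = x @ i # y" "[s] @ v \<approx> x @ y"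
      using crossing_delete[of v "[s]"] l assms by auto
    have "u \<approx> rev [s] @ v" using assms l by (intro cong_shift) auto
    also have "rev [s] @ v = [s] @ v" by simp
    also note xy(2)
    finally have "length u \<le> length (x @ y)" using assms reduced_length_le by blast
    with assms(4) xy(1) show False by simp
  qed
  from crossing_delete[OF this l(1)] assms that show thesis by auto
qed

section \<open>Alternating words below the order of a product\<close>

text \<open>With \<open>B\<close> the bilinear form of the geometric representation, \<open>edge i j\<close> is \<open>-2 B(e\<^sub>i,
  e\<^sub>j)\<close>.\<close>

definition edge :: "'i \<Rightarrow> 'i \<Rightarrow> real" where
  "edge i j = (if i = j then - 2 else case m i j of enat n \<Rightarrow> 2 * cos (pi / real n) | \<infinity> \<Rightarrow> 2)"

text \<open>The action of \<open>s\<^sub>i\<close> on the dual of the geometric representation: a linear form \<open>p\<close> is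
  given by its values on the simple roots and goes to \<open>p \<circ> s\<^sub>i\<close>. A word acts by firing its
  letters from left to right.\<close>

definition fire :: "'i \<Rightarrow> ('i \<Rightarrow> real) \<Rightarrow> 'i \<Rightarrow> real" where
  "fire i p = (\<lambda>j. p j + edge i j * p i)"

lemma edge_sym: "i \<in> I \<Longrightarrow> j \<in> I \<Longrightarrow> edge i j = edge j i"
  using m_sym[of i j] by (auto simp: edge_def)

lemma edge_self [simp]: "edge i i = - 2"
  by (simp add: edge_def)

text \<open>When \<open>a\<close> and \<open>b\<close> are fired in turn, the values fired form one sequence with a linear
  recurrence. After \<open>k\<close> steps the letter whose turn is next carries the next term, and the
  letter fired last carries the negative of the term just fired.\<close>

lemma fold_fire_alt_word:
  assumes "edge a b = c" "edge b a = c"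
    and "Y 0 = - p b" "Y 1 = p a" "\<And>n. Y (n + 2) = c * Y (n + 1) - Y n"
  shows "if even k
    then fold fire (alt_word a b k) p a = Y (k + 1) \<and> fold fire (alt_word a b k) p b = - Y k
    else fold fire (alt_word a b k) p b = Y (k + 1) \<and> fold fire (alt_word a b k) p a = - Y k"
  using assms
proof (induction k arbitrary: a b p Y)
  case (Suc k)
  have "if even k
    then fold fire (alt_word b a k) (fire a p) b = Y (Suc (k + 1)) \<and>
      fold fire (alt_word b a k) (fire a p) a = - Y (Suc k)
    else fold fire (alt_word b a k) (fire a p) a = Y (Suc (k + 1)) \<and>
      fold fire (alt_word b a k) (fire a p) b = - Y (Suc k)"
  proof (rule Suc.IH)
    show "Y (Suc 1) = fire a p b" using Suc.prems(5)[of 0] Suc.prems(1-4) by (simp add: fire_def numeral_2_eq_2)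
    show "Y (Suc 0) = - fire a p a" using Suc.prems by (simp add: fire_def)
    show "Y (Suc (n + 2)) = c * Y (Suc (n + 1)) - Y (Suc n)" for n
      using Suc.prems(5)[of "Suc n"] by simp
  qed (use Suc.prems in auto)
  then show ?case by (auto split: if_splits)
qed (simp_all)

text \<open>Firing \<open>a\<close> and \<open>b\<close> only adds multiples of \<open>edge a\<close> and \<open>edge b\<close>. Two unknown coefficients
  thus describe the total change, and they can be determined from the values at \<open>a\<close> and \<open>b\<close>.\<close>

lemma fold_fire_shift:
  "\<exists>e f. \<forall>j. fold fire (concat (replicate n [a, b])) p j = p j + edge a j * e + edge b j * f"
proof (induction n arbitrary: p)
  case (Suc n)
  from Suc[of "fire b (fire a p)"] obtain e f where
    "\<And>j. fold fire (concat (replicate n [a, b])) (fire b (fire a p)) j =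
      fire b (fire a p) j + edge a j * e + edge b j * f" by blast
  then have "\<forall>j. fold fire (concat (replicate (Suc n) [a, b])) p j =
      p j + edge a j * (e + p a) + edge b j * (f + fire a p b)"
    by (simp add: fire_def algebra_simps)
  then show ?case by blast
qed (auto intro: exI[of _ 0])

text \<open>If \<open>sin t \<noteq> 0\<close>, the solution of the recurrence \<open>Y (k + 2) = 2 cos t Y (k + 1) - Y k\<close> with
  \<open>Y 0 = - y\<close> and \<open>Y 1 = x\<close>.\<close>

definition wave :: "real \<Rightarrow> real \<Rightarrow> real \<Rightarrow> nat \<Rightarrow> real" where
  "wave t x y k = (x * sin (k * t) + y * sin (k * t - t)) / sin t"

lemma wave_0: "sin t \<noteq> 0 \<Longrightarrow> wave t x y 0 = - y"
  and wave_1: "sin t \<noteq> 0 \<Longrightarrow> wave t x y 1 = x"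
  by (simp_all add: wave_def)

lemma wave_rec: "wave t x y (k + 2) = 2 * cos t * wave t x y (k + 1) - wave t x y k"
proof -
  have r: "sin (z + t) = 2 * cos t * sin z - sin (z - t)" for z
    by (simp add: sin_add sin_diff)
  have 1: "sin (real (k + 2) * t) = 2 * cos t * sin (real (k + 1) * t) - sin (real k * t)"
    using r[of "real (k + 1) * t"] by (simp add: algebra_simps)
  have 2: "sin (real (k + 2) * t - t) = 2 * cos t * sin (real (k + 1) * t - t) - sin (real k * t - t)"
    using r[of "real k * t"] by (simp add: algebra_simps)
  show ?thesis unfolding wave_def 1 2
    by (simp add: add_divide_distrib diff_divide_distrib right_diff_distrib distrib_left mult.left_commute)
qed

text \<open>For \<open>a \<noteq> b\<close> and \<open>t = \<pi> / n\<close> the sequence of fired values has period \<open>2n\<close>, so \<open>(ab)\<^sup>n\<close>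
  fixes the values at \<open>a\<close> and \<open>b\<close>. The two coefficients of \<open>fold_fire_shift\<close> then solve a
  homogeneous system with nonzero determinant, so all other values are fixed too.\<close>

lemma fold_fire_relator:
  assumes "a \<in> I" "b \<in> I" "m a b = enat n"
  shows "fold fire (concat (replicate n [a, b])) p = p"
proof (cases "a = b")
  case True
  then have "n = 1" using m_diag assms by (simp add: one_enat_def)
  then show ?thesis using True by (auto simp: fire_def fun_eq_iff)
next
  case False
  define t where "t = pi / real n"
  define c where "c = 2 * cos t"
  have n: "n \<ge> 2" using m_ge_2[of a b] assms False by (simp add: numeral_eq_enat)
  then have "0 < t" "t < pi" by (auto simp: t_def field_simps)
  then have st: "sin t > 0" by (rule sin_gt_zero)
  have c: "edge a b = c" "edge b a = c"
    using assms False edge_sym[of a b] by (auto simp: edge_def c_def t_def)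
  define Y where "Y = wave t (p a) (p b)"
  have Y0: "Y 0 = - p b" "Y 1 = p a" using st wave_0 wave_1 by (auto simp: Y_def)
  have Yrec: "Y (k + 2) = c * Y (k + 1) - Y k" for k
    unfolding Y_def c_def by (rule wave_rec)
  have per: "Y (2 * n + k) = Y k" for k
  proof -
    have "real (2 * n + k) * t = real k * t + 2 * pi"
      using n by (simp add: t_def field_simps)
    moreover from this have "real (2 * n + k) * t - t = (real k * t - t) + 2 * pi" by simp
    ultimately show ?thesis unfolding Y_def wave_def by (simp only: sin_periodic)
  qed
  define q where "q = fold fire (concat (replicate n [a, b])) p"
  have "q a = Y (2 * n + 1)" "q b = - Y (2 * n + 0)"
    using fold_fire_alt_word[OF c, of Y p "2 * n", OF Y0 Yrec]
    by (auto simp: q_def alt_word_even)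
  then have q: "q a = p a" "q b = p b" using per[of 0] per[of 1] Y0 by auto
  obtain e f where ef: "\<And>j. q j = p j + edge a j * e + edge b j * f"
    using fold_fire_shift[of n a b p] unfolding q_def by blast
  have "2 * e = c * f" "2 * f = c * e" using ef[of a] ef[of b] q c by auto
  then have e: "e = cos t * f" and f: "f = cos t * e" by (auto simp: c_def)
  have "x * (sin t)^2 = x - cos t * (cos t * x)" for x
    unfolding sin_squared_eq by (simp add: algebra_simps power2_eq_square)
  from this[of e] this[of f] have "e * (sin t)^2 = 0" "f * (sin t)^2 = 0"
    by (simp_all flip: e f)
  then have "e = 0" "f = 0" using st by auto
  then show ?thesis using ef by (auto simp: q_def fun_eq_iff)
qed

lemma fold_fire_cong: "u \<approx> v \<Longrightarrow> fold fire u p = fold fire v p"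
  by (induction arbitrary: p rule: cong_induct) (auto simp: fold_fire_relator)

text \<open>Act on the constant function 1. All fired terms up to and including the one numbered \<open>m a
  b\<close> are positive, so after fewer than \<open>m a b\<close> steps the letter fired last carries a negative
  value and the other letter a positive one. The two alternating words end in different
  letters.\<close>

lemma alt_word_not_cong:
  assumes "a \<in> I" "b \<in> I" "a \<noteq> b" "0 < k" "enat k < m a b"
  shows "\<not> alt_word a b k \<approx> alt_word b a k"
proof
  assume eq: "alt_word a b k \<approx> alt_word b a k"
  have "\<exists>Y. Y 0 = -1 \<and> Y 1 = (1::real) \<and> (\<forall>n. Y (n + 2) = edge a b * Y (n + 1) - Y n)
     \<and> Y k > 0 \<and> Y (k + 1) > 0"
  proof (cases "m a b")
    case (enat n)
    define t where "t = pi / real n"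
    have n: "n \<ge> 2" using m_ge_2[of a b] assms enat by (simp add: numeral_eq_enat)
    then have "0 < t" "t < pi" by (auto simp: t_def field_simps)
    then have st: "sin t > 0" by (rule sin_gt_zero)
    have c: "edge a b = 2 * cos t" using enat assms by (simp add: edge_def t_def)
    define Y where "Y = wave t 1 1"
    have "Y (j + 2) = edge a b * Y (j + 1) - Y j" for j
      unfolding Y_def c by (rule wave_rec)
    moreover have "Y 0 = -1" "Y 1 = 1" using st wave_0 wave_1 by (auto simp: Y_def)
    moreover have "Y j > 0" if "0 < j" "j \<le> n" for j
    proof (cases "j = n")
      case True
      have "real n * t = pi" using n by (simp add: t_def)
      then show ?thesis using True st by (simp add: Y_def wave_def)
    next
      case False
      with that have "j < n" by simp
      then have "0 < real j * t" "real j * t < pi"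
        using that \<open>0 < t\<close> by (auto simp: t_def field_simps)
      then have 1: "sin (real j * t) > 0" by (rule sin_gt_zero)
      have "0 \<le> real j * t - t" using that \<open>0 < t\<close> by simp
      then have "sin (real j * t - t) \<ge> 0"
        using \<open>real j * t < pi\<close> \<open>0 < t\<close> by (intro sin_ge_zero) auto
      with 1 show ?thesis using st by (simp add: Y_def wave_def)
    qed
    ultimately show ?thesis using assms enat by (intro exI[of _ Y]) auto
  next
    case infinity
    then show ?thesis using assms
      by (intro exI[of _ "\<lambda>n. 2 * real n - 1"]) (auto simp: edge_def)
  qed
  then obtain Y :: "nat \<Rightarrow> real" where Y: "Y 0 = -1" "Y 1 = 1"
    "\<And>n. Y (n + 2) = edge a b * Y (n + 1) - Y n" "Y k > 0" "Y (k + 1) > 0" by blast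
  have s: "edge b a = edge a b" using assms by (simp add: edge_sym)
  let ?p = "\<lambda>_. 1 :: real"
  from fold_fire_alt_word[of a b "edge a b" Y ?p k] fold_fire_alt_word[of b a "edge a b" Y ?p k]
  show False
    using fold_fire_cong[OF eq, of ?p] Y s by (auto split: if_splits)
qed

section \<open>The theorems of Matsumoto and Tits\<close>

inductive braid_move :: "'i set set \<Rightarrow> 'i list \<Rightarrow> 'i list \<Rightarrow> bool" for J where
  "{a, b} \<in> J \<Longrightarrow> braid_move J (x @ braid_word m a b @ y) (x @ braid_word m b a @ y)"

abbreviation braid_eq :: "'i set set \<Rightarrow> 'i list \<Rightarrow> 'i list \<Rightarrow> bool" where
  "braid_eq J \<equiv> (braid_move J)\<^sup>*\<^sup>*"

lemma braid_pairsD: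
  assumes "{a, b} \<in> braid_pairs I m"
  shows "a \<in> I" "b \<in> I" "a \<noteq> b" "m b a = m a b" "m a b < \<infinity>"
  using assms m_sym by (auto simp: braid_pairs_def doubleton_eq_iff)

lemma length_braid_word:
  "{a, b} \<in> braid_pairs I m \<Longrightarrow> length (braid_word m a b) = length (braid_word m b a)"
  by (simp add: braid_word_def braid_pairsD(4))

lemma braid_word_in_lists:
  assumes "{a, b} \<in> braid_pairs I m"
  shows "braid_word m a b \<in> lists I" "braid_word m b a \<in> lists I"
  using braid_pairsD(1,2)[OF assms] by (simp_all add: braid_word_def alt_word_in_lists del: in_listsI)

lemma rev_alt_word: "rev (alt_word a b n) = (if even n then alt_word b a n else alt_word a b n)"
proof (induction n arbitrary: a b)
  case (Suc n)
  then show ?case using alt_word_snoc[of a b n] alt_word_snoc[of b a n] by auto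
qed simp

text \<open>The relator \<open>(ab)\<^sup>n\<close> is one side of the braid relation followed by the reverse, that is
  the inverse, of the other side.\<close>

lemma braid_word_cong:
  assumes "{a, b} \<in> braid_pairs I m"
  shows "braid_word m a b \<approx> braid_word m b a"
proof -
  from braid_pairsD[OF assms] obtain n where n: "a \<in> I" "b \<in> I" "m a b = enat n" "m b a = enat n"
    by auto
  have "alt_word a b (2 * n) \<approx> []" using cong_rel[of a b n] n by (simp add: alt_word_even)
  also have "[] \<approx> alt_word b a n @ rev (alt_word b a n)"
    using n by (intro cong_sym[OF cong_append_rev] alt_word_in_lists)
  also have "alt_word a b (2 * n) = alt_word a b n @ rev (alt_word b a n)"
    using alt_word_add[of a b n n] by (simp add: rev_alt_word mult_2)
  finally show ?thesis using n by (simp add: braid_word_def cong_cancel_right)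
qed

lemma braid_move_sym: "braid_move J u v \<Longrightarrow> braid_move J v u"
  by (erule braid_move.cases) (use braid_move.intros in \<open>simp add: insert_commute\<close>)

lemma braid_eq_sym: "braid_eq J u v \<Longrightarrow> braid_eq J v u"
  using symp_rtranclp[of "braid_move J"] braid_move_sym by (blast intro: sympI dest: sympD)

lemma braid_eq_context: "braid_eq J u v \<Longrightarrow> braid_eq J (x @ u @ y) (x @ v @ y)"
proof (induction rule: rtranclp_induct)
  case (step v w)
  from step(2) have "braid_move J (x @ v @ y) (x @ w @ y)"
  proof cases
    case (1 a b x' y')
    then show ?thesis using braid_move.intros[of a b J "x @ x'" "y' @ y"] by simp
  qed
  with step(3) show ?case by simp
qed simp

lemma braid_eq_cong:
  assumes "braid_eq J u v" "J \<subseteq> braid_pairs I m" "u \<in> lists I"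
  shows "u \<approx> v"
  using assms
proof (induction rule: rtranclp_induct)
  case (step v w)
  then have uv: "u \<approx> v" by blast
  from step(2) have "v \<approx> w"
  proof cases
    case (1 a b x y)
    then show ?thesis
      using cong_in_lists(2)[OF uv] step(4) by (auto intro!: cong_context braid_word_cong)
  qed
  with uv show ?case by (rule cong_trans)
qed (simp add: cong_refl)

lemma braid_eq_length:
  assumes "braid_eq J u v" "J \<subseteq> braid_pairs I m"
  shows "length u = length v"
  using assms
  by (induction rule: rtranclp_induct)
     (auto simp: braid_move.simps dest!: subsetD length_braid_word)

lemma braid_eq_in_lists:
  "braid_eq J u v \<Longrightarrow> J \<subseteq> braid_pairs I m \<Longrightarrow> u \<in> lists I \<Longrightarrow> v \<in> lists I"
  using braid_eq_cong cong_in_lists by blast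

lemma two_letter_reduced:
  "reduced (c # w) \<Longrightarrow> set w \<subseteq> {c, d} \<Longrightarrow> c # w = alt_word c d (Suc (length w))"
proof (induction w arbitrary: c d)
  case (Cons e w)
  have "e \<noteq> c" using Cons.prems(1) reduced_no_square[of "[]" c w] by auto
  then have e: "e = d" using Cons.prems by auto
  moreover have "reduced (e # w)" using Cons.prems(1) reduced_factor[of "[c]" "e # w" "[]"] by simp
  ultimately have "e # w = alt_word d c (Suc (length w))"
    using Cons.IH[of d c] Cons.prems by auto
  then show ?case by simp
qed simp

lemma set_alt_word: "set (alt_word a b n) \<subseteq> {a, b}"
  by (induction n arbitrary: a b) auto

text \<open>Two alternating words of length \<open>k\<close> can only agree if \<open>k \<ge> m a b\<close>. If \<open>k\<close> were larger, a
  braid move on the initial segment of length \<open>m a b\<close> would produce a square at its end.\<close>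

lemma alt_word_reduced_length:
  assumes "a \<in> I" "b \<in> I" "a \<noteq> b" "0 < k" "reduced (alt_word a b k)"
    and "alt_word a b k \<approx> alt_word b a k"
  shows "m a b = enat k"
proof -
  have "m a b \<le> enat k" using alt_word_not_cong assms not_le by blast
  then obtain n where n: "m a b = enat n" "n \<le> k" by (cases "m a b") auto
  have "n \<ge> 2" using m_ge_2[of a b] assms n by (simp add: numeral_eq_enat)
  have "n = k"
  proof (rule ccontr)
    assume "n \<noteq> k"
    with n have "n < k" by simp
    define l where "l = k - n - 1"
    define e f where "e = (if even n then a else b)" and "f = (if even n then b else a)"
    have k: "alt_word a b k = alt_word a b n @ alt_word e f (Suc l)"
      using alt_word_add[of a b n "Suc l"] \<open>n < k\<close> by (simp add: l_def e_def f_def)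
    have n': "alt_word b a n = alt_word b a (n - 1) @ [e]"
      using alt_word_snoc[of b a "n - 1"] \<open>n \<ge> 2\<close> by (auto simp: e_def)
    have ab: "{a, b} \<in> braid_pairs I m" using assms n by (auto simp: braid_pairs_def)
    have "alt_word a b n \<approx> alt_word b a n"
      using braid_word_cong[OF ab] braid_pairsD(4)[OF ab] n by (simp add: braid_word_def)
    then have "alt_word a b k \<approx> alt_word b a n @ alt_word e f (Suc l)"
      unfolding k using assms by (intro cong_append cong_refl alt_word_in_lists) (auto simp: e_def f_def)
    then have "reduced (alt_word b a n @ alt_word e f (Suc l))"
      using assms(5) by (rule_tac reduced_if_cong) (auto simp: k)
    then show False using n' reduced_no_square by simp
  qed
  with n show ?thesis by simp
qed

text \<open>Induction on the length; words with the same first letter follow from the induction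
  hypothesis for their tails. If the first letters are \<open>a \<noteq> b\<close>, take a reduced expression \<open>x\<close> of
  the same element that begins with a longest possible alternating word in \<open>a\<close> and \<open>b\<close>, say
  \<open>cdc\<dots>\<close> with \<open>j\<close> letters. The exchange property moves a letter \<open>d\<close> to the front of \<open>x\<close>. The
  letter that it replaces lies inside the alternating prefix, since otherwise the prefix could
  be made longer. So \<open>cdc\<dots>\<close> and \<open>dcd\<dots>\<close> with \<open>j\<close> letters agree, which forces \<open>j = m c d\<close>.
  Therefore \<open>x\<close> is one braid move away from a word that begins with \<open>d\<close>, and \<open>x\<close> itself begins
  with \<open>c\<close>: the two given words are reached from these by the case of equal first letters.\<close>

theorem matsumoto:
  "reduced u \<Longrightarrow> reduced v \<Longrightarrow> u \<approx> v \<Longrightarrow> braid_eq (braid_pairs I m) u v"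
proof (induction "length u" arbitrary: u v rule: less_induct)
  case less
  note len = reduced_cong_length[OF less.prems]
  have same_head: "braid_eq (braid_pairs I m) (s # x) (s # y)"
    if "reduced (s # x)" "reduced (s # y)" "s # x \<approx> s # y" "Suc (length x) = length u" for s x y
  proof -
    have "reduced x" "reduced y" using that reduced_factor[of "[s]" _ "[]"] by auto
    moreover have "x \<approx> y" using that(3) cong_cancel_left[of "[s]"] by auto
    ultimately have "braid_eq (braid_pairs I m) x y" using less.hyps that(4) by auto
    then show ?thesis using braid_eq_context[of _ x y "[s]" "[]"] by simp
  qed
  show ?case
  proof (cases u)
    case Nil
    then show ?thesis using len by simp
  next
    case (Cons a u')
    then obtain b v' where v: "v = b # v'" using len by (cases v) auto
    show ?thesis
    proof (cases "a = b")
      case True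
      then show ?thesis using same_head[of a u' v'] less.prems Cons v by simp
    next
      case False
      have ab: "a \<in> I" "b \<in> I" using less.prems Cons v reduced_in_lists by fastforce+
      define P where "P j \<longleftrightarrow> (\<exists>c d y. {c, d} = {a, b} \<and> reduced (alt_word c d j @ y)
          \<and> u \<approx> alt_word c d j @ y)" for j
      have "u \<approx> u" using less.prems reduced_in_lists cong_refl by blast
      then have "P 1" unfolding P_def using Cons less.prems
        by (intro exI[of _ a] exI[of _ b] exI[of _ u']) auto
      moreover have "j \<le> length u" if "P j" for j
        using that less.prems unfolding P_def
        by (metis reduced_cong_length length_alt_word length_append le_add1)
      ultimately obtain j where j: "P j" "\<And>i. P i \<Longrightarrow> i \<le> j"
        using Nat.ex_has_greatest_nat[of P 1 "length u"] by blast
      then have j0: "0 < j" using \<open>P 1\<close> by fastforce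
      from j(1) obtain c d y where cd: "{c, d} = {a, b}"
        and red: "reduced (alt_word c d j @ y)" and ux: "u \<approx> alt_word c d j @ y"
        unfolding P_def by blast
      define x where "x = alt_word c d j @ y"
      have x: "reduced x" "u \<approx> x" "length x = length u"
        using red ux reduced_cong_length[OF less.prems(1) red ux] by (auto simp: x_def)
      have cd': "c \<noteq> d" "c \<in> I" "d \<in> I" using cd False ab by (auto simp: doubleton_eq_iff)
      \<comment> \<open>The roles of \<open>u\<close> and \<open>v\<close> are fixed by which of them begins with \<open>c\<close>.\<close>
      obtain p q where pq: "reduced (c # p)" "reduced (d # q)" "c # p \<approx> x" "d # q \<approx> x"
        "(u = c # p \<and> v = d # q) \<or> (v = c # p \<and> u = d # q)"
      proof -
        have "v \<approx> x" using less.prems(3) x(2) cong_sym cong_trans by metis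
        with that[of u' v'] that[of v' u'] cd x less.prems show thesis
          unfolding Cons v by (auto simp: doubleton_eq_iff)
      qed
      have lpq: "Suc (length p) = length u" "Suc (length q) = length u"
        using pq(5) len by auto
      have "d # x \<approx> d # d # q"
        using cong_append[of "[d]" "[d]" x "d # q"] cong_refl[of "[d]"] cong_sym[OF pq(4)] cd' by simp
      also have "d # d # q \<approx> q"
        using cong_cancel_pair[of d "[]" q] cd' reduced_in_lists[OF pq(2)] by simp
      finally have "d # x \<approx> q" .
      then obtain x1 i x2 where xs: "x = x1 @ i # x2" "d # x \<approx> x1 @ x2"
        using exchange[OF x(1) cd'(3)] lpq x(3) by (metis le_SucI le_refl)
      have "x \<approx> d # x1 @ x2"
        using cong_shift[of "[d]" x "x1 @ x2"] xs(2) cd' reduced_in_lists[OF x(1)] by simp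
      moreover from this have "reduced (d # x1 @ x2)"
        using x(1) xs(1) by (rule_tac reduced_if_cong) auto
      ultimately have z: "x \<approx> d # x1 @ x2" "reduced (d # x1 @ x2)" by auto
      \<comment> \<open>A letter deleted beyond the prefix would leave \<open>d\<close> in front of all of it, against maximality.\<close>
      have "length x1 < j"
      proof (rule ccontr)
        assume "\<not> length x1 < j"
        then have "take j x1 = alt_word c d j"
          using arg_cong[OF xs(1), of "take j"] by (simp add: x_def)
        then have eq: "d # x1 @ x2 = alt_word d c (Suc j) @ (drop j x1 @ x2)"
          using append_take_drop_id[of j x1] by (metis alt_word.simps(2) append_Cons append_assoc)
        moreover have "u \<approx> d # x1 @ x2" using x(2) z(1) by (rule cong_trans)
        moreover have "{d, c} = {a, b}" using cd by auto
        ultimately have "P (Suc j)" unfolding P_def using z(2) by metis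
        then show False using j(2) by fastforce
      qed
      then obtain x3 where x3: "alt_word c d j = x1 @ i # x3" "x2 = x3 @ y"
      proof -
        have "x1 @ i # x2 = alt_word c d j @ y" using xs(1) x_def by simp
        then obtain r where "x1 @ r = alt_word c d j" "i # x2 = r @ y"
          using \<open>length x1 < j\<close> by (auto simp: append_eq_append_conv2)
        then show thesis using that[of "tl r"] \<open>length x1 < j\<close> by (cases r) auto
      qed
      have lj: "Suc (length (x1 @ x3)) = j" using arg_cong[OF x3(1), of length] by simp
      \<comment> \<open>A reduced word in two letters is alternating, so only its first letter and length matter.\<close>
      have "reduced (d # x1 @ x3)" using z(2) x3(2) reduced_factor[of "[]" "d # x1 @ x3" y] by simp
      moreover have "set (x1 @ x3) \<subseteq> {d, c}" using set_alt_word[of c d j] x3(1) by auto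
      ultimately have alt: "d # x1 @ x3 = alt_word d c j"
        using two_letter_reduced[of d "x1 @ x3" c] unfolding lj by blast
      then have xz: "x \<approx> alt_word d c j @ y" "reduced (alt_word d c j @ y)"
        using z x3(2) by (metis append_Cons append_assoc)+
      then have "alt_word c d j \<approx> alt_word d c j"
        unfolding x_def by (rule_tac cong_cancel_right)
      moreover have "reduced (alt_word c d j)" using red reduced_factor[of "[]"] by simp
      ultimately have mj: "m c d = enat j" using alt_word_reduced_length cd' j0 by blast
      then have J: "{c, d} \<in> braid_pairs I m" using cd' by (auto simp: braid_pairs_def)
      obtain j' where j': "j = Suc j'" using j0 by (cases j) auto
      have "braid_eq (braid_pairs I m) (c # p) x"
        unfolding x_def j' alt_word.simps append_Cons using pq x lpq
        by (intro same_head) (auto simp: x_def j')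
      moreover have "braid_move (braid_pairs I m) x (alt_word d c j @ y)"
        using braid_move.intros[OF J, of "[]" y] mj braid_pairsD(4)[OF J] by (simp add: braid_word_def x_def)
      moreover have "braid_eq (braid_pairs I m) (alt_word d c j @ y) (d # q)"
        unfolding x_def j' alt_word.simps append_Cons using pq x lpq xz
        by (intro same_head) (auto simp: x_def j' intro: cong_sym cong_trans)
      ultimately have "braid_eq (braid_pairs I m) (c # p) (d # q)" by auto
      then show ?thesis using pq(5) braid_eq_sym by blast
    qed
  qed
qed

text \<open>Let \<open>u @ [s]\<close> be the first prefix that is not reduced. By parity, the element of \<open>u @ [s]\<close>
  has an expression \<open>v\<close> with fewer letters than \<open>u\<close>. Then \<open>v @ [s]\<close> is a reduced expression of
  the element of \<open>u\<close>, so that Matsumoto's theorem transforms \<open>u @ [s]\<close> into \<open>v @ [s, s]\<close>.\<close>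

theorem tits_word:
  assumes "u \<in> lists I" "\<not> reduced u"
  obtains x i y where "braid_eq (braid_pairs I m) u (x @ i # i # y)"
proof -
  have "\<exists>x i y. braid_eq (braid_pairs I m) u (x @ i # i # y)"
    using assms
  proof (induction u rule: rev_induct)
    case Nil
    then show ?case by (simp add: reduced_def)
  next
    case (snoc s u)
    show ?case
    proof (cases "reduced u")
      case False
      then obtain x i y where "braid_eq (braid_pairs I m) u (x @ i # i # y)"
        using snoc by auto
      then have "braid_eq (braid_pairs I m) (u @ [s]) (x @ i # i # (y @ [s]))"
        using braid_eq_context[of _ u "x @ i # i # y" "[]" "[s]"] by simp
      then show ?thesis by blast
    next
      case True
      obtain v where v: "u @ [s] \<approx> v" "length v < Suc (length u)"
        using snoc.prems unfolding reduced_def by auto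
      have l: "v \<in> lists I" "s \<in> I" "u \<in> lists I" using cong_in_lists[OF v(1)] snoc.prems by auto
      have "odd (length v) \<longleftrightarrow> even (length u)" using cong_even_length[OF v(1)] by auto
      then have "length v \<noteq> length u" by auto
      then have lv: "length (v @ [s]) \<le> length u" using v(2) by simp
      have "u \<approx> u @ [s, s]"
        using cong_sym[OF cong_cancel_pair[of s u "[]"]] l by simp
      also have "u @ [s, s] \<approx> v @ [s]"
        using cong_append[OF v(1) cong_refl[of "[s]"]] l by simp
      finally have uv: "u \<approx> v @ [s]" .
      have "braid_eq (braid_pairs I m) u (v @ [s])"
        using True reduced_if_cong[OF True uv lv] uv by (rule matsumoto)
      from braid_eq_context[OF this, of "[]" "[s]"]
      have "braid_eq (braid_pairs I m) (u @ [s]) (v @ s # s # [])" by simp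
      then show ?thesis by blast
    qed
  qed
  with that show thesis by blast
qed

section \<open>Vanishing words and the set of elements that index the basis\<close>

abbreviation elem :: "'i list \<Rightarrow> 'i list set" where
  "elem u \<equiv> coxeter_cong I m `` {u}"

lemma elem_eq_iff: "u \<in> lists I \<Longrightarrow> v \<in> lists I \<Longrightarrow> elem u = elem v \<longleftrightarrow> u \<approx> v"
  using eq_equiv_class_iff[OF cong_equiv] by (simp add: cong_def)

lemma elem_mult:
  assumes "u \<in> lists I" "v \<in> lists I"
  shows "elem u \<otimes>\<^bsub>coxeter_group I m\<^esub> elem v = elem (u @ v)"
proof -
  have "elem (x @ y) = elem (u @ v)" if "x \<in> elem u" "y \<in> elem v" for x y
  proof -
    have "u @ v \<approx> x @ y" using that by (intro cong_append) (auto simp: cong_def)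
    then show ?thesis
      using elem_eq_iff[of "x @ y" "u @ v"] cong_in_lists cong_sym by blast
  qed
  moreover have "u \<in> elem u" "v \<in> elem v"
    using assms cong_refl by (auto simp: cong_def)
  ultimately show ?thesis unfolding coxeter_group_def monoid.simps by blast
qed

lemma word_prod_simple_refl:
  "u \<in> lists I \<Longrightarrow> word_prod (coxeter_group I m) (simple_refl I m) u = elem u"
proof (induction u)
  case (Cons i u)
  then have "simple_refl I m i \<otimes>\<^bsub>coxeter_group I m\<^esub> elem u = elem (i # u)"
    using elem_mult[of "[i]" u] by (simp add: simple_refl_def)
  with Cons show ?case by (simp add: word_prod_def)
qed (simp add: word_prod_def coxeter_group_def)

lemma reduced_expr_iff: "reduced_expr I m u w \<longleftrightarrow> reduced u \<and> w = elem u"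
proof -
  have "expresses I m v w \<longleftrightarrow> v \<in> lists I \<and> w = elem v" for v
    unfolding expresses_def using word_prod_simple_refl by auto
  then show ?thesis
    unfolding reduced_expr_def reduced_def using elem_eq_iff cong_in_lists by metis
qed

lemma carrier_coxeter_group: "carrier (coxeter_group I m) = elem ` lists I"
  by (auto simp: coxeter_group_def quotient_def)

lemma ex_reduced_expr:
  assumes "w \<in> carrier (coxeter_group I m)"
  obtains u where "reduced u" "w = elem u"
proof -
  from assms obtain v where v: "v \<in> lists I" "w = elem v" by (auto simp: carrier_coxeter_group)
  from ex_reduced[OF v(1)] obtain u where "reduced u" "v \<approx> u" by blast
  moreover from this have "elem v = elem u"
    using elem_eq_iff cong_in_lists by metis
  ultimately show thesis using that v by blast
qed

text \<open>Up to the braid relations in \<open>J\<close>, these words contain the left side of one of the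
  relations \<open>ii = 0\<close> or of one of the monomial relations outside \<open>J\<close>: they are the words that
  become zero in the algebra.\<close>

definition vanishing :: "'i set set \<Rightarrow> 'i list \<Rightarrow> bool" where
  "vanishing J u \<longleftrightarrow> (\<exists>x y. (\<exists>i. braid_eq J u (x @ [i, i] @ y)) \<or>
     (\<exists>a b. {a, b} \<in> braid_pairs I m - J \<and> braid_eq J u (x @ braid_word m a b @ y)))"

lemma vanishing_square: "vanishing J [i, i]"
  unfolding vanishing_def by (metis append_Nil append_Nil2 rtranclp.rtrancl_refl)

lemma vanishing_braid_word: "{a, b} \<in> braid_pairs I m - J \<Longrightarrow> vanishing J (braid_word m a b)"
  unfolding vanishing_def by (metis append_Nil append_Nil2 rtranclp.rtrancl_refl)

lemma vanishing_context:
  assumes "vanishing J u" shows "vanishing J (p @ u @ q)"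
proof -
  from assms obtain x y z where "braid_eq J u (x @ z @ y)"
    and z: "(\<exists>i. z = [i, i]) \<or> (\<exists>a b. {a, b} \<in> braid_pairs I m - J \<and> z = braid_word m a b)"
    unfolding vanishing_def by blast
  then have "braid_eq J (p @ u @ q) ((p @ x) @ z @ (y @ q))"
    using braid_eq_context[of J u "x @ z @ y" p q] by simp
  with z show ?thesis unfolding vanishing_def by blast
qed

text \<open>A braid move outside \<open>J\<close> needs a word that contains a killed side of a braid relation.\<close>

lemma braid_eq_if_not_vanishing:
  assumes "braid_eq (braid_pairs I m) u v" "\<not> vanishing J u"
  shows "braid_eq J u v"
  using assms(1)
proof induction
  case (step v w)
  from step(2) show ?case
  proof cases
    case (1 a b x y)
    then have "{a, b} \<in> J" using step.IH assms(2) unfolding vanishing_def by blast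
    then have "braid_move J v w" using 1 by (simp add: braid_move.intros)
    with step.IH show ?thesis by simp
  qed
qed simp

lemma reduced_if_not_vanishing:
  assumes "u \<in> lists I" "\<not> vanishing J u"
  shows "reduced u"
proof (rule ccontr)
  assume "\<not> reduced u"
  with assms(1) obtain x i y where "braid_eq (braid_pairs I m) u (x @ i # i # y)"
    by (rule tits_word)
  from braid_eq_if_not_vanishing[OF this assms(2)] have "braid_eq J u (x @ [i, i] @ y)"
    by simp
  with assms(2) show False unfolding vanishing_def by blast
qed

lemma reduced_braid_eq:
  assumes "reduced u" "braid_eq J u v" "J \<subseteq> braid_pairs I m"
  shows "reduced v" "elem u = elem v"
proof -
  have l: "u \<in> lists I" using assms(1) by (rule reduced_in_lists)
  have c: "u \<approx> v" using braid_eq_cong[OF assms(2,3) l] .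
  then show "reduced v"
    using assms(1) braid_eq_length[OF assms(2,3)] by (intro reduced_if_cong[OF _ c]) auto
  show "elem u = elem v" using c l cong_in_lists(2)[OF c] elem_eq_iff by blast
qed

text \<open>From left to right, words related by braid moves to a reduced word are reduced expressions
  of the same element. From right to left, Matsumoto's theorem reaches every reduced expression
  from \<open>u\<close> by braid moves, and \<open>braid_eq_if_not_vanishing\<close> keeps these moves within \<open>J\<close>.\<close>

lemma elem_in_W_sub_iff:
  assumes u: "reduced u" and J: "J \<subseteq> braid_pairs I m"
  shows "elem u \<in> W_sub I m J \<longleftrightarrow> \<not> vanishing J u"
proof
  have l: "u \<in> lists I" using u by (rule reduced_in_lists)
  have expr: "reduced v \<and> elem u = elem v" if "braid_eq J u v" for v
    using reduced_braid_eq[OF u that J] by blast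
  assume W: "elem u \<in> W_sub I m J"
  show "\<not> vanishing J u"
  proof
    assume "vanishing J u"
    then obtain x y i a b where
      "braid_eq J u (x @ [i, i] @ y) \<or>
       {a, b} \<in> braid_pairs I m - J \<and> braid_eq J u (x @ braid_word m a b @ y)"
      unfolding vanishing_def by blast
    then show False
    proof
      assume "braid_eq J u (x @ [i, i] @ y)"
      then show False using expr reduced_no_square[of x i y] by fastforce
    next
      assume "{a, b} \<in> braid_pairs I m - J \<and> braid_eq J u (x @ braid_word m a b @ y)"
      then show False using expr W unfolding W_sub_def reduced_expr_iff by blast
    qed
  qed
next
  have l: "u \<in> lists I" using u by (rule reduced_in_lists)
  assume nv: "\<not> vanishing J u"
  have "\<not> sublist (braid_word m a b) v"
    if v: "reduced v" "elem u = elem v" and ab: "{a, b} \<in> braid_pairs I m - J" for v a b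
  proof
    assume "sublist (braid_word m a b) v"
    then obtain x y where xy: "v = x @ braid_word m a b @ y" by (auto simp: sublist_def)
    have "u \<approx> v" using v l reduced_in_lists elem_eq_iff by blast
    then have "braid_eq J u v"
      using braid_eq_if_not_vanishing matsumoto u v nv by blast
    with nv ab show False unfolding vanishing_def xy by blast
  qed
  then show "elem u \<in> W_sub I m J"
    using l unfolding W_sub_def reduced_expr_iff carrier_coxeter_group by blast
qed

lemma finite_reduced_exprs:
  assumes "finite I" shows "finite {u. reduced u \<and> elem u = w}"
proof (cases "\<exists>v. reduced v \<and> elem v = w")
  case True
  then obtain v where v: "reduced v" "elem v = w" by blast
  have "{u. reduced u \<and> elem u = w} \<subseteq> {u. set u \<subseteq> I \<and> length u = length v}"
  proof clarify
    fix u assume "reduced u" "w = elem u"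
    moreover from this have "u \<approx> v" using v elem_eq_iff reduced_in_lists by metis
    ultimately show "set u \<subseteq> I \<and> length u = length v"
      using v reduced_cong_length reduced_in_lists by (auto simp: in_lists_conv_set)
  qed
  then show ?thesis by (rule finite_subset) (rule finite_lists_length_eq[OF assms])
next
  case False
  then have "{u. reduced u \<and> elem u = w} = {}" by blast
  then show ?thesis by (simp only: finite.emptyI)
qed

end

section \<open>The free algebra\<close>

text \<open>This allows elements to be expanded in a family one term at a time, although the new index
  may already occur with a coefficient.\<close>

lemma (in module) linear_combination_add:
  assumes b: "b \<in> X \<rightarrow> carrier M" and x: "x \<in> X" and a: "a \<in> carrier R"
    and Y: "finite Y" "Y \<subseteq> X" "c \<in> Y \<rightarrow> carrier R"
  shows "\<exists>Z d. finite Z \<and> Z \<subseteq> X \<and> d \<in> Z \<rightarrow> carrier R \<and>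
    a \<odot>\<^bsub>M\<^esub> b x \<oplus>\<^bsub>M\<^esub> (\<Oplus>\<^bsub>M\<^esub>y\<in>Y. c y \<odot>\<^bsub>M\<^esub> b y) = (\<Oplus>\<^bsub>M\<^esub>y\<in>Z. d y \<odot>\<^bsub>M\<^esub> b y)"
proof -
  define e where "e = (if x \<in> Y then a \<oplus> c x else a)"
  define d where "d = c(x := e)"
  have e: "e \<in> carrier R" using a Y by (auto simp: e_def)
  have bx: "b x \<in> carrier M" using b x by auto
  have cl: "(\<lambda>y. c y \<odot>\<^bsub>M\<^esub> b y) \<in> Y - {x} \<rightarrow> carrier M" using b Y by (auto simp: Pi_def)
  have sum: "(\<Oplus>\<^bsub>M\<^esub>y\<in>insert x Y. d y \<odot>\<^bsub>M\<^esub> b y) = e \<odot>\<^bsub>M\<^esub> b x \<oplus>\<^bsub>M\<^esub> (\<Oplus>\<^bsub>M\<^esub>y\<in>Y - {x}. c y \<odot>\<^bsub>M\<^esub> b y)"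
  proof -
    have "(\<Oplus>\<^bsub>M\<^esub>y\<in>insert x (Y - {x}). d y \<odot>\<^bsub>M\<^esub> b y) =
        d x \<odot>\<^bsub>M\<^esub> b x \<oplus>\<^bsub>M\<^esub> (\<Oplus>\<^bsub>M\<^esub>y\<in>Y - {x}. d y \<odot>\<^bsub>M\<^esub> b y)"
      using Y e bx cl by (intro finsum_insert) (auto simp: d_def Pi_def)
    also have "(\<Oplus>\<^bsub>M\<^esub>y\<in>Y - {x}. d y \<odot>\<^bsub>M\<^esub> b y) = (\<Oplus>\<^bsub>M\<^esub>y\<in>Y - {x}. c y \<odot>\<^bsub>M\<^esub> b y)"
      using cl by (intro M.finsum_cong') (auto simp: d_def)
    finally show ?thesis by (simp add: d_def)
  qed
  have "a \<odot>\<^bsub>M\<^esub> b x \<oplus>\<^bsub>M\<^esub> (\<Oplus>\<^bsub>M\<^esub>y\<in>Y. c y \<odot>\<^bsub>M\<^esub> b y) =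
      e \<odot>\<^bsub>M\<^esub> b x \<oplus>\<^bsub>M\<^esub> (\<Oplus>\<^bsub>M\<^esub>y\<in>Y - {x}. c y \<odot>\<^bsub>M\<^esub> b y)"
  proof (cases "x \<in> Y")
    case True
    then have cx: "c x \<in> carrier R" using Y by auto
    have "(\<Oplus>\<^bsub>M\<^esub>y\<in>Y. c y \<odot>\<^bsub>M\<^esub> b y) = (\<Oplus>\<^bsub>M\<^esub>y\<in>insert x (Y - {x}). c y \<odot>\<^bsub>M\<^esub> b y)"
      using True by (simp add: insert_absorb)
    also have "\<dots> = c x \<odot>\<^bsub>M\<^esub> b x \<oplus>\<^bsub>M\<^esub> (\<Oplus>\<^bsub>M\<^esub>y\<in>Y - {x}. c y \<odot>\<^bsub>M\<^esub> b y)"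
      using Y bx cx cl by (intro finsum_insert) auto
    finally show ?thesis
      using True a bx cx cl by (simp add: e_def smult_l_distr M.a_assoc M.finsum_closed)
  next
    case False
    then show ?thesis by (simp add: e_def)
  qed
  with sum have "a \<odot>\<^bsub>M\<^esub> b x \<oplus>\<^bsub>M\<^esub> (\<Oplus>\<^bsub>M\<^esub>y\<in>Y. c y \<odot>\<^bsub>M\<^esub> b y) = (\<Oplus>\<^bsub>M\<^esub>y\<in>insert x Y. d y \<odot>\<^bsub>M\<^esub> b y)"
    by simp
  moreover have "d \<in> insert x Y \<rightarrow> carrier R" using Y e by (auto simp: d_def Pi_def)
  ultimately show ?thesis using Y x by (intro exI[of _ "insert x Y"] exI[of _ d]) auto
qed

lemma (in abelian_monoid) finsum_triangle_swap:
  fixes k :: nat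
  assumes "\<And>i n. i \<le> n \<Longrightarrow> n \<le> k \<Longrightarrow> T i n \<in> carrier G"
  shows "(\<Oplus>n\<in>{..k}. \<Oplus>i\<in>{..n}. T i n) = (\<Oplus>i\<in>{..k}. \<Oplus>j\<in>{..k - i}. T i (i + j))"
  using assms
proof (induction k)
  case (Suc k)
  have *: "(\<Oplus>j\<in>{..Suc k - i}. T i (i + j)) = T i (Suc k) \<oplus> (\<Oplus>j\<in>{..k - i}. T i (i + j))"
    if "i \<le> k" for i
    using that Suc.prems by (subst Suc_diff_le[OF that], subst finsum_Suc) auto
  have "(\<Oplus>n\<in>{..Suc k}. \<Oplus>i\<in>{..n}. T i n) =
      (\<Oplus>i\<in>{..Suc k}. T i (Suc k)) \<oplus> (\<Oplus>n\<in>{..k}. \<Oplus>i\<in>{..n}. T i n)"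
    using Suc.prems by (subst finsum_Suc) auto
  also have "\<dots> = (T (Suc k) (Suc k) \<oplus> (\<Oplus>i\<in>{..k}. T i (Suc k))) \<oplus>
      (\<Oplus>i\<in>{..k}. \<Oplus>j\<in>{..k - i}. T i (i + j))"
    using Suc.prems by (subst finsum_Suc, force, subst Suc.IH) auto
  also have "\<dots> = T (Suc k) (Suc k) \<oplus> ((\<Oplus>i\<in>{..k}. T i (Suc k)) \<oplus>
      (\<Oplus>i\<in>{..k}. \<Oplus>j\<in>{..k - i}. T i (i + j)))"
    using Suc.prems by (subst a_assoc) (auto intro!: finsum_closed)
  also have "(\<Oplus>i\<in>{..k}. T i (Suc k)) \<oplus> (\<Oplus>i\<in>{..k}. \<Oplus>j\<in>{..k - i}. T i (i + j)) =
      (\<Oplus>i\<in>{..k}. T i (Suc k) \<oplus> (\<Oplus>j\<in>{..k - i}. T i (i + j)))"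
    using Suc.prems by (subst finsum_addf) (auto intro!: finsum_closed)
  also have "\<dots> = (\<Oplus>i\<in>{..k}. \<Oplus>j\<in>{..Suc k - i}. T i (i + j))"
    using Suc.prems by (intro finsum_cong') (auto simp: * intro!: finsum_closed)
  also have "T (Suc k) (Suc k) = (\<Oplus>j\<in>{..Suc k - Suc k}. T (Suc k) (Suc k + j))"
    using Suc.prems by (simp add: finsum_0)
  also have "\<dots> \<oplus> (\<Oplus>i\<in>{..k}. \<Oplus>j\<in>{..Suc k - i}. T i (i + j)) =
      (\<Oplus>i\<in>{..Suc k}. \<Oplus>j\<in>{..Suc k - i}. T i (i + j))"
    using Suc.prems by (subst finsum_Suc) (auto intro!: finsum_closed)
  finally show ?case .
qed (simp add: finsum_0)

locale free_algebra_over = cring K for K :: "('k, 'c) ring_scheme" (structure) +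
  fixes I :: "'i set"
begin

abbreviation F :: "('k, 'i list \<Rightarrow> 'k) module" where
  "F \<equiv> free_algebra K I"

definition monomial :: "'i list \<Rightarrow> 'i list \<Rightarrow> 'k" where
  "monomial u = (\<lambda>v. if v = u then \<one> else \<zero>)"

lemma F_carrier: "f \<in> carrier F \<longleftrightarrow>
    (\<forall>u. f u \<in> carrier K) \<and> (\<forall>u. u \<notin> lists I \<longrightarrow> f u = \<zero>) \<and> finite {u. f u \<noteq> \<zero>}"
  by (simp add: free_algebra_def)

lemma F_closed [simp]: "f \<in> carrier F \<Longrightarrow> f u \<in> carrier K"
  by (simp add: F_carrier)

lemma F_add: "f \<oplus>\<^bsub>F\<^esub> g = (\<lambda>u. f u \<oplus> g u)"
  and F_zero: "\<zero>\<^bsub>F\<^esub> = (\<lambda>u. \<zero>)"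
  and F_smult: "a \<odot>\<^bsub>F\<^esub> f = (\<lambda>u. a \<otimes> f u)"
  and F_mult: "f \<otimes>\<^bsub>F\<^esub> g = (\<lambda>u. \<Oplus>n\<in>{..length u}. f (take n u) \<otimes> g (drop n u))"
  and F_one: "\<one>\<^bsub>F\<^esub> = monomial []"
  unfolding free_algebra_def monomial_def
  by (simp_all only: monoid.simps ring.simps module.simps)

lemma monomial_closed [simp]: "u \<in> lists I \<Longrightarrow> monomial u \<in> carrier F"
  by (auto simp: F_carrier monomial_def)

lemma monomial_apply_closed [simp]: "monomial u v \<in> carrier K"
  by (simp add: monomial_def)

lemma F_mult_closed:
  assumes "f \<in> carrier F" "g \<in> carrier F"
  shows "f \<otimes>\<^bsub>F\<^esub> g \<in> carrier F"
proof -
  have zero: "(f \<otimes>\<^bsub>F\<^esub> g) u = \<zero>"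
    if "\<And>n. n \<le> length u \<Longrightarrow> f (take n u) = \<zero> \<or> g (drop n u) = \<zero>" for u
  proof -
    have "(f \<otimes>\<^bsub>F\<^esub> g) u = (\<Oplus>n\<in>{..length u}. \<zero>)"
      unfolding F_mult
    proof (intro finsum_cong' refl)
      fix n assume "n \<in> {..length u}"
      then have "f (take n u) = \<zero> \<or> g (drop n u) = \<zero>" using that by simp
      then show "f (take n u) \<otimes> g (drop n u) = \<zero>" using assms by auto
    qed auto
    then show ?thesis by simp
  qed
  have "(f \<otimes>\<^bsub>F\<^esub> g) u = \<zero>" if "u \<notin> lists I" for u
  proof (rule zero)
    fix n
    have "take n u \<notin> lists I \<or> drop n u \<notin> lists I"
      using that append_take_drop_id[of n u] append_in_lists_conv by metis
    then show "f (take n u) = \<zero> \<or> g (drop n u) = \<zero>"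
      using assms unfolding F_carrier by blast
  qed
  moreover have "{u. (f \<otimes>\<^bsub>F\<^esub> g) u \<noteq> \<zero>} \<subseteq>
      (\<lambda>(x, y). x @ y) ` ({u. f u \<noteq> \<zero>} \<times> {u. g u \<noteq> \<zero>})"
  proof
    fix u assume "u \<in> {u. (f \<otimes>\<^bsub>F\<^esub> g) u \<noteq> \<zero>}"
    then obtain n where "f (take n u) \<noteq> \<zero>" "g (drop n u) \<noteq> \<zero>" using zero by blast
    then show "u \<in> (\<lambda>(x, y). x @ y) ` ({u. f u \<noteq> \<zero>} \<times> {u. g u \<noteq> \<zero>})"
      by (intro image_eqI[of _ _ "(take n u, drop n u)"]) auto
  qed
  then have "finite {u. (f \<otimes>\<^bsub>F\<^esub> g) u \<noteq> \<zero>}"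
    using assms by (rule_tac finite_subset) (auto simp: F_carrier)
  moreover have "(f \<otimes>\<^bsub>F\<^esub> g) u \<in> carrier K" for u
    unfolding F_mult using assms by (intro finsum_closed) auto
  ultimately show ?thesis by (simp add: F_carrier)
qed

lemma F_add_closed: "f \<in> carrier F \<Longrightarrow> g \<in> carrier F \<Longrightarrow> f \<oplus>\<^bsub>F\<^esub> g \<in> carrier F"
  unfolding F_carrier F_add
  by (auto intro: finite_subset[of _ "{u. f u \<noteq> \<zero>} \<union> {u. g u \<noteq> \<zero>}"])

lemma F_smult_closed: "a \<in> carrier K \<Longrightarrow> f \<in> carrier F \<Longrightarrow> a \<odot>\<^bsub>F\<^esub> f \<in> carrier F"
  unfolding F_carrier F_smult
  by (auto intro: finite_subset[of _ "{u. f u \<noteq> \<zero>}"])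

lemma F_zero_closed: "\<zero>\<^bsub>F\<^esub> \<in> carrier F"
  by (simp add: F_carrier F_zero)

lemma F_abelian_group: "abelian_group F"
proof (rule abelian_groupI)
  fix f assume f: "f \<in> carrier F"
  have "(\<ominus> \<one>) \<odot>\<^bsub>F\<^esub> f \<oplus>\<^bsub>F\<^esub> f = \<zero>\<^bsub>F\<^esub>"
    using f by (auto simp: F_add F_smult F_zero l_minus l_neg)
  then show "\<exists>g\<in>carrier F. g \<oplus>\<^bsub>F\<^esub> f = \<zero>\<^bsub>F\<^esub>"
    using f F_smult_closed[of "\<ominus> \<one>" f] by auto
next
  fix f g h assume fgh: "f \<in> carrier F" "g \<in> carrier F" "h \<in> carrier F"
  show "(f \<oplus>\<^bsub>F\<^esub> g) \<oplus>\<^bsub>F\<^esub> h = f \<oplus>\<^bsub>F\<^esub> (g \<oplus>\<^bsub>F\<^esub> h)"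
    using fgh by (simp add: F_add a_assoc)
next
  fix f g assume fg: "f \<in> carrier F" "g \<in> carrier F"
  show "f \<oplus>\<^bsub>F\<^esub> g = g \<oplus>\<^bsub>F\<^esub> f"
    using fg by (simp add: F_add a_comm)
next
  fix f assume "f \<in> carrier F"
  then show "\<zero>\<^bsub>F\<^esub> \<oplus>\<^bsub>F\<^esub> f = f"
    by (simp add: F_add F_zero)
qed (fact F_add_closed F_zero_closed)+

lemma F_mult_assoc:
  assumes "f \<in> carrier F" "g \<in> carrier F" "h \<in> carrier F"
  shows "(f \<otimes>\<^bsub>F\<^esub> g) \<otimes>\<^bsub>F\<^esub> h = f \<otimes>\<^bsub>F\<^esub> (g \<otimes>\<^bsub>F\<^esub> h)"
proof
  fix u
  let ?T = "\<lambda>i n. f (take i u) \<otimes> (g (take (n - i) (drop i u)) \<otimes> h (drop n u))"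
  have T: "?T i n \<in> carrier K" for i n using assms by auto
  have "((f \<otimes>\<^bsub>F\<^esub> g) \<otimes>\<^bsub>F\<^esub> h) u = (\<Oplus>n\<in>{..length u}. \<Oplus>i\<in>{..n}. ?T i n)"
    unfolding F_mult
  proof (intro finsum_cong' refl)
    fix n assume n: "n \<in> {..length u}"
    have "(\<Oplus>i\<in>{..length (take n u)}. f (take i (take n u)) \<otimes> g (drop i (take n u))) \<otimes> h (drop n u) =
      (\<Oplus>i\<in>{..length (take n u)}. f (take i (take n u)) \<otimes> g (drop i (take n u)) \<otimes> h (drop n u))"
      using assms by (intro finsum_ldistr) auto
    also have "\<dots> = (\<Oplus>i\<in>{..n}. ?T i n)"
      using n assms by (intro finsum_cong') (auto simp: m_assoc drop_take min_def)
    finally show "(\<Oplus>i\<in>{..length (take n u)}. f (take i (take n u)) \<otimes> g (drop i (take n u)))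
       \<otimes> h (drop n u) = (\<Oplus>i\<in>{..n}. ?T i n)" .
  qed (use T in \<open>auto intro!: finsum_closed\<close>)
  also have "\<dots> = (\<Oplus>i\<in>{..length u}. \<Oplus>j\<in>{..length u - i}. ?T i (i + j))"
    using T by (intro finsum_triangle_swap)
  also have "\<dots> = (f \<otimes>\<^bsub>F\<^esub> (g \<otimes>\<^bsub>F\<^esub> h)) u"
    unfolding F_mult
  proof (intro finsum_cong' refl)
    fix i assume i: "i \<in> {..length u}"
    have "f (take i u) \<otimes> (\<Oplus>j\<in>{..length (drop i u)}. g (take j (drop i u)) \<otimes> h (drop j (drop i u))) =
      (\<Oplus>j\<in>{..length (drop i u)}. f (take i u) \<otimes> (g (take j (drop i u)) \<otimes> h (drop j (drop i u))))"
      using assms by (intro finsum_rdistr) auto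
    then show "(\<Oplus>j\<in>{..length u - i}. ?T i (i + j)) =
      f (take i u) \<otimes> (\<Oplus>j\<in>{..length (drop i u)}. g (take j (drop i u)) \<otimes> h (drop j (drop i u)))"
      by (simp add: add.commute)
  qed (use assms in \<open>auto intro!: finsum_closed\<close>)
  finally show "((f \<otimes>\<^bsub>F\<^esub> g) \<otimes>\<^bsub>F\<^esub> h) u = (f \<otimes>\<^bsub>F\<^esub> (g \<otimes>\<^bsub>F\<^esub> h)) u" .
qed

lemma F_smult_mult_left:
  assumes "a \<in> carrier K" "f \<in> carrier F" "g \<in> carrier F"
  shows "(a \<odot>\<^bsub>F\<^esub> f) \<otimes>\<^bsub>F\<^esub> g = a \<odot>\<^bsub>F\<^esub> (f \<otimes>\<^bsub>F\<^esub> g)"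
  using assms unfolding F_mult F_smult
  by (auto simp: finsum_rdistr m_assoc fun_eq_iff intro!: finsum_cong')

lemma F_smult_mult_right:
  assumes "a \<in> carrier K" "f \<in> carrier F" "g \<in> carrier F"
  shows "f \<otimes>\<^bsub>F\<^esub> (a \<odot>\<^bsub>F\<^esub> g) = a \<odot>\<^bsub>F\<^esub> (f \<otimes>\<^bsub>F\<^esub> g)"
  using assms unfolding F_mult F_smult
  by (auto simp: finsum_rdistr m_lcomm fun_eq_iff intro!: finsum_cong')

lemma monomial_mult: "monomial u \<otimes>\<^bsub>F\<^esub> monomial v = monomial (u @ v)"
proof
  fix w
  have eq: "(take n w = u \<and> drop n w = v) \<longleftrightarrow> (w = u @ v \<and> n = length u)" if "n \<le> length w" for n
    using that by auto
  have "(monomial u \<otimes>\<^bsub>F\<^esub> monomial v) w =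
      (\<Oplus>n\<in>{..length w}. if length u = n then (if w = u @ v then \<one> else \<zero>) else \<zero>)"
    unfolding F_mult
  proof (intro finsum_cong' refl)
    fix n assume "n \<in> {..length w}"
    then show "monomial u (take n w) \<otimes> monomial v (drop n w) =
        (if length u = n then (if w = u @ v then \<one> else \<zero>) else \<zero>)"
      using eq[of n] by (auto simp: monomial_def)
  qed auto
  also have "\<dots> = monomial (u @ v) w"
  proof (cases "w = u @ v")
    case True
    then show ?thesis
      using finsum_singleton[of "length u" "{..length w}" "\<lambda>_. if w = u @ v then \<one> else \<zero>"]
      by (simp add: monomial_def)
  qed (simp add: monomial_def)
  finally show "(monomial u \<otimes>\<^bsub>F\<^esub> monomial v) w = monomial (u @ v) w" .
qed

lemma F_mult_one_left:
  assumes "f \<in> carrier F" shows "\<one>\<^bsub>F\<^esub> \<otimes>\<^bsub>F\<^esub> f = f"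
proof
  fix u
  have "(\<one>\<^bsub>F\<^esub> \<otimes>\<^bsub>F\<^esub> f) u = (\<Oplus>n\<in>{..length u}. if 0 = n then f u else \<zero>)"
    unfolding F_mult F_one monomial_def using assms by (intro finsum_cong') auto
  then show "(\<one>\<^bsub>F\<^esub> \<otimes>\<^bsub>F\<^esub> f) u = f u"
    using finsum_singleton[of 0 "{..length u}" "\<lambda>_. f u"] assms by simp
qed

lemma F_mult_one_right:
  assumes "f \<in> carrier F" shows "f \<otimes>\<^bsub>F\<^esub> \<one>\<^bsub>F\<^esub> = f"
proof
  fix u
  have "(f \<otimes>\<^bsub>F\<^esub> \<one>\<^bsub>F\<^esub>) u = (\<Oplus>n\<in>{..length u}. if length u = n then f u else \<zero>)"
    unfolding F_mult F_one monomial_def using assms by (intro finsum_cong') auto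
  then show "(f \<otimes>\<^bsub>F\<^esub> \<one>\<^bsub>F\<^esub>) u = f u"
    using finsum_singleton[of "length u" "{..length u}" "\<lambda>_. f u"] assms by simp
qed

lemma F_ring: "ring F"
proof (rule ringI[OF F_abelian_group])
  have "\<one>\<^bsub>F\<^esub> \<in> carrier F" by (simp add: F_one)
  then show "Group.monoid F"
    by (rule_tac monoidI)
      (auto intro: F_mult_closed F_mult_assoc F_mult_one_left F_mult_one_right)
  fix f g h assume fgh: "f \<in> carrier F" "g \<in> carrier F" "h \<in> carrier F"
  show "(f \<oplus>\<^bsub>F\<^esub> g) \<otimes>\<^bsub>F\<^esub> h = f \<otimes>\<^bsub>F\<^esub> h \<oplus>\<^bsub>F\<^esub> g \<otimes>\<^bsub>F\<^esub> h"
    unfolding F_add F_mult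
  proof
    fix u
    show "(\<Oplus>n\<in>{..length u}. (f (take n u) \<oplus> g (take n u)) \<otimes> h (drop n u)) =
        (\<Oplus>n\<in>{..length u}. f (take n u) \<otimes> h (drop n u)) \<oplus>
        (\<Oplus>n\<in>{..length u}. g (take n u) \<otimes> h (drop n u))"
      by (subst finsum_addf[symmetric]) (use fgh in \<open>auto simp: l_distr intro!: finsum_cong'\<close>)
  qed
  show "h \<otimes>\<^bsub>F\<^esub> (f \<oplus>\<^bsub>F\<^esub> g) = h \<otimes>\<^bsub>F\<^esub> f \<oplus>\<^bsub>F\<^esub> h \<otimes>\<^bsub>F\<^esub> g"
    unfolding F_add F_mult
  proof
    fix u
    show "(\<Oplus>n\<in>{..length u}. h (take n u) \<otimes> (f (drop n u) \<oplus> g (drop n u))) =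
        (\<Oplus>n\<in>{..length u}. h (take n u) \<otimes> f (drop n u)) \<oplus>
        (\<Oplus>n\<in>{..length u}. h (take n u) \<otimes> g (drop n u))"
      by (subst finsum_addf[symmetric]) (use fgh in \<open>auto simp: r_distr intro!: finsum_cong'\<close>)
  qed
qed

lemma F_module: "module K F"
  by (intro moduleI is_cring F_abelian_group F_smult_closed)
     (auto simp: F_add F_smult fun_eq_iff l_distr r_distr m_assoc)

sublocale F: ring F by (rule F_ring)
sublocale F: module K F by (rule F_module)

lemma word_prod_free_gen: "word_prod F (free_gen K) u = monomial u"
proof (induction u)
  case Nil
  then show ?case by (simp add: word_prod_def F_one)
next
  case (Cons i u)
  have "free_gen K i = monomial [i]" by (simp add: free_gen_def monomial_def)
  with Cons show ?case by (simp add: word_prod_def monomial_mult)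
qed

lemma free_algebra_induct [consumes 1, case_names zero add]:
  assumes "f \<in> carrier F" and zero: "P \<zero>\<^bsub>F\<^esub>"
    and add: "\<And>a u f. \<lbrakk>a \<in> carrier K; u \<in> lists I; f \<in> carrier F; P f\<rbrakk>
      \<Longrightarrow> P (a \<odot>\<^bsub>F\<^esub> monomial u \<oplus>\<^bsub>F\<^esub> f)"
  shows "P f"
proof -
  have "P f" if "finite S" "f \<in> carrier F" "{u. f u \<noteq> \<zero>} \<subseteq> S" for S f
    using that
  proof (induction S arbitrary: f)
    case empty
    then have "f = \<zero>\<^bsub>F\<^esub>" by (auto simp: F_zero)
    with zero show ?case by simp
  next
    case (insert u S)
    show ?case
    proof (cases "f u = \<zero>")
      case True
      then show ?thesis using insert by (metis (mono_tags, lifting) mem_Collect_eq subset_insert)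
    next
      case False
      then have u: "u \<in> lists I" using insert.prems by (auto simp: F_carrier)
      have f': "f(u := \<zero>) \<in> carrier F"
        using insert.prems by (auto simp: F_carrier intro: finite_subset[of _ "{u. f u \<noteq> \<zero>}"])
      have "f = f u \<odot>\<^bsub>F\<^esub> monomial u \<oplus>\<^bsub>F\<^esub> f(u := \<zero>)"
        using insert.prems by (auto simp: F_add F_smult monomial_def)
      moreover have "P (f(u := \<zero>))"
        using insert.prems by (intro insert.IH f') auto
      ultimately show ?thesis using add[of "f u" u "f(u := \<zero>)"] u f' insert.prems by simp
    qed
  qed
  with assms(1) show ?thesis by (auto simp: F_carrier)
qed

section \<open>Ideals spanned by monomials and binomials\<close>

text \<open>For a set \<open>Z\<close> of words and a relation \<open>E\<close> on words, both stable under multiplication by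
  words, this submodule is already a two-sided ideal. In contrast to the ideal generated by the
  same elements, it allows a linear functional to be evaluated generator by generator.\<close>

inductive_set binomial_span :: "('i list \<Rightarrow> bool) \<Rightarrow> ('i list \<Rightarrow> 'i list \<Rightarrow> bool) \<Rightarrow> ('i list \<Rightarrow> 'k) set"
  for Z and E where
  zero: "\<zero>\<^bsub>F\<^esub> \<in> binomial_span Z E"
| add: "f \<in> binomial_span Z E \<Longrightarrow> g \<in> binomial_span Z E \<Longrightarrow> f \<oplus>\<^bsub>F\<^esub> g \<in> binomial_span Z E"
| word: "a \<in> carrier K \<Longrightarrow> u \<in> lists I \<Longrightarrow> Z u \<Longrightarrow> a \<odot>\<^bsub>F\<^esub> monomial u \<in> binomial_span Z E"
| pair: "a \<in> carrier K \<Longrightarrow> u \<in> lists I \<Longrightarrow> v \<in> lists I \<Longrightarrow> E u v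
    \<Longrightarrow> a \<odot>\<^bsub>F\<^esub> monomial u \<oplus>\<^bsub>F\<^esub> (\<ominus> a) \<odot>\<^bsub>F\<^esub> monomial v \<in> binomial_span Z E"

lemma binomial_span_closed: "f \<in> binomial_span Z E \<Longrightarrow> f \<in> carrier F"
  by (induction rule: binomial_span.induct) auto

lemma binomial_span_smult:
  assumes "f \<in> binomial_span Z E" "a \<in> carrier K"
  shows "a \<odot>\<^bsub>F\<^esub> f \<in> binomial_span Z E"
  using assms(1)
proof induction
  case (add f g)
  then show ?case using assms(2) binomial_span_closed
    by (auto simp: F.smult_r_distr intro: binomial_span.add)
next
  case (word b u)
  then show ?case using assms(2) binomial_span.word[of "a \<otimes> b" u Z E]
    by (simp add: F.smult_assoc1)
next
  case (pair b u v)
  then show ?case using assms(2) binomial_span.pair[of "a \<otimes> b" u v E Z]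
    by (simp add: F.smult_assoc1 F.smult_r_distr flip: r_minus)
qed (use assms(2) in \<open>auto intro: binomial_span.zero\<close>)

lemma binomial_span_monomial_mult:
  assumes "f \<in> binomial_span Z E" "w \<in> lists I"
    and "\<And>u x y. Z u \<Longrightarrow> Z (x @ u @ y)" "\<And>u v x y. E u v \<Longrightarrow> E (x @ u @ y) (x @ v @ y)"
  shows "monomial w \<otimes>\<^bsub>F\<^esub> f \<in> binomial_span Z E" "f \<otimes>\<^bsub>F\<^esub> monomial w \<in> binomial_span Z E"
proof -
  have Z: "Z (x @ u)" "Z (u @ x)" if "Z u" for x u
    using assms(3)[OF that, of x "[]"] assms(3)[OF that, of "[]" x] by auto
  have E: "E (x @ u) (x @ v)" "E (u @ x) (v @ x)" if "E u v" for x u v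
    using assms(4)[OF that, of x "[]"] assms(4)[OF that, of "[]" x] by auto
  from assms(1) have "monomial w \<otimes>\<^bsub>F\<^esub> f \<in> binomial_span Z E \<and> f \<otimes>\<^bsub>F\<^esub> monomial w \<in> binomial_span Z E"
  proof induction
    case (add f g)
    then show ?case using assms(2) binomial_span_closed
      by (auto simp: F.l_distr F.r_distr intro: binomial_span.add)
  next
    case (word b u)
    then show ?case using assms(2) Z
      by (auto simp: F_smult_mult_left F_smult_mult_right monomial_mult intro!: binomial_span.word)
  next
    case (pair b u v)
    then show ?case using assms(2) E
      by (auto simp: F_smult_mult_left F_smult_mult_right monomial_mult F.l_distr F.r_distr
          intro!: binomial_span.pair)
  qed (use assms(2) in \<open>auto intro: binomial_span.zero\<close>)
  then show "monomial w \<otimes>\<^bsub>F\<^esub> f \<in> binomial_span Z E" "f \<otimes>\<^bsub>F\<^esub> monomial w \<in> binomial_span Z E"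
    by auto
qed

lemma binomial_span_ideal:
  assumes "\<And>u x y. Z u \<Longrightarrow> Z (x @ u @ y)" "\<And>u v x y. E u v \<Longrightarrow> E (x @ u @ y) (x @ v @ y)"
  shows "ideal (binomial_span Z E) F"
proof (rule idealI[OF F_ring])
  show "subgroup (binomial_span Z E) (add_monoid F)"
  proof (rule subgroup.intro)
    fix f assume f: "f \<in> binomial_span Z E"
    then have "\<ominus>\<^bsub>F\<^esub> f = (\<ominus> \<one>) \<odot>\<^bsub>F\<^esub> f"
      using binomial_span_closed F.smult_l_minus[of \<one> f] by simp
    then show "inv\<^bsub>add_monoid F\<^esub> f \<in> binomial_span Z E"
      using binomial_span_smult[OF f, of "\<ominus> \<one>"] by (simp add: a_inv_def)
  qed (auto intro: binomial_span.intros binomial_span_closed)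
next
  fix f g assume f: "f \<in> binomial_span Z E" and g: "g \<in> carrier F"
  have fc: "f \<in> carrier F" using f by (rule binomial_span_closed)
  note mm = binomial_span_monomial_mult[OF f _ assms]
  show "g \<otimes>\<^bsub>F\<^esub> f \<in> binomial_span Z E"
    using g
  proof (induction rule: free_algebra_induct)
    case (add a u g)
    then have "(a \<odot>\<^bsub>F\<^esub> monomial u \<oplus>\<^bsub>F\<^esub> g) \<otimes>\<^bsub>F\<^esub> f = a \<odot>\<^bsub>F\<^esub> (monomial u \<otimes>\<^bsub>F\<^esub> f) \<oplus>\<^bsub>F\<^esub> g \<otimes>\<^bsub>F\<^esub> f"
      using fc by (simp add: F.l_distr F_smult_mult_left)
    then show ?case using add mm by (auto intro!: binomial_span.add binomial_span_smult)
  qed (use fc in \<open>simp add: binomial_span.zero\<close>)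
  show "f \<otimes>\<^bsub>F\<^esub> g \<in> binomial_span Z E"
    using g
  proof (induction rule: free_algebra_induct)
    case (add a u g)
    then have "f \<otimes>\<^bsub>F\<^esub> (a \<odot>\<^bsub>F\<^esub> monomial u \<oplus>\<^bsub>F\<^esub> g) = a \<odot>\<^bsub>F\<^esub> (f \<otimes>\<^bsub>F\<^esub> monomial u) \<oplus>\<^bsub>F\<^esub> f \<otimes>\<^bsub>F\<^esub> g"
      using fc by (simp add: F.r_distr F_smult_mult_right)
    then show ?case using add mm by (auto intro!: binomial_span.add binomial_span_smult)
  qed (use fc in \<open>simp add: binomial_span.zero\<close>)
qed

text \<open>For a class \<open>C\<close> of words, \<open>coeff_sum C\<close> turns into the coordinate function of \<open>C\<close> on the
  quotient.\<close>

definition coeff_sum :: "'i list set \<Rightarrow> ('i list \<Rightarrow> 'k) \<Rightarrow> 'k" where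
  "coeff_sum C f = (\<Oplus>u\<in>C. f u)"

lemma coeff_sum_closed [simp]: "f \<in> carrier F \<Longrightarrow> coeff_sum C f \<in> carrier K"
  unfolding coeff_sum_def by (intro finsum_closed) auto

lemma coeff_sum_add:
  "f \<in> carrier F \<Longrightarrow> g \<in> carrier F \<Longrightarrow> coeff_sum C (f \<oplus>\<^bsub>F\<^esub> g) = coeff_sum C f \<oplus> coeff_sum C g"
  unfolding coeff_sum_def F_add by (intro finsum_addf) auto

lemma coeff_sum_zero: "coeff_sum C \<zero>\<^bsub>F\<^esub> = \<zero>"
  by (simp add: coeff_sum_def F_zero)

lemma coeff_sum_smult_monomial:
  assumes "finite C" "a \<in> carrier K"
  shows "coeff_sum C (a \<odot>\<^bsub>F\<^esub> monomial u) = (if u \<in> C then a else \<zero>)"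
proof -
  have "coeff_sum C (a \<odot>\<^bsub>F\<^esub> monomial u) = (\<Oplus>v\<in>C. if u = v then a else \<zero>)"
    unfolding coeff_sum_def F_smult monomial_def using assms by (intro finsum_cong') auto
  also have "\<dots> = (if u \<in> C then a else \<zero>)"
  proof (cases "u \<in> C")
    case True
    then show ?thesis using assms finsum_singleton[of u C "\<lambda>_. a"] by simp
  next
    case False
    then have "(\<Oplus>v\<in>C. if u = v then a else \<zero>) = (\<Oplus>v\<in>C. \<zero>)"
      by (intro finsum_cong') auto
    then show ?thesis using False by simp
  qed
  finally show ?thesis .
qed

text \<open>A word in \<open>Z\<close> does not meet \<open>C\<close>, and the two terms of a difference have the same
  membership in \<open>C\<close>, so that their contributions cancel.\<close>

lemma coeff_sum_binomial_span:
  assumes "f \<in> binomial_span Z E" "finite C"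
    and "\<And>u. Z u \<Longrightarrow> u \<notin> C" "\<And>u v. E u v \<Longrightarrow> u \<in> C \<longleftrightarrow> v \<in> C"
  shows "coeff_sum C f = \<zero>"
  using assms(1)
proof induction
  case zero
  then show ?case by (rule coeff_sum_zero)
next
  case (add f g)
  then show ?case using binomial_span_closed by (simp add: coeff_sum_add)
next
  case (word a u)
  then show ?case using assms by (simp add: coeff_sum_smult_monomial)
next
  case (pair a u v)
  then show ?case using assms(4)[of u v] assms(2) by (simp add: coeff_sum_add coeff_sum_smult_monomial r_neg)
qed

end

section \<open>Quotients of the free algebra\<close>

locale free_algebra_quotient = free_algebra_over K I + N: ideal N "free_algebra K I"
  for K :: "('k, 'c) ring_scheme" (structure) and I :: "'i set" and N
begin

abbreviation Q :: "('k, ('i list \<Rightarrow> 'k) set) module" where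
  "Q \<equiv> quot_algebra F N"

abbreviation proj :: "('i list \<Rightarrow> 'k) \<Rightarrow> ('i list \<Rightarrow> 'k) set" where
  "proj f \<equiv> N +>\<^bsub>F\<^esub> f"

lemma Q_carrier: "carrier Q = proj ` carrier F"
  by (auto simp: quot_algebra_def ring.extend_def FactRing_def A_RCOSETS_def' a_r_coset_def')

lemma Q_zero: "\<zero>\<^bsub>Q\<^esub> = N"
  by (simp add: quot_algebra_def ring.extend_def FactRing_def)

lemma Q_one: "\<one>\<^bsub>Q\<^esub> = proj \<one>\<^bsub>F\<^esub>"
  by (simp add: quot_algebra_def ring.extend_def FactRing_def)

lemma Q_add: "f \<in> carrier F \<Longrightarrow> g \<in> carrier F \<Longrightarrow> proj f \<oplus>\<^bsub>Q\<^esub> proj g = proj (f \<oplus>\<^bsub>F\<^esub> g)"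
  by (simp add: quot_algebra_def ring.extend_def FactRing_def N.a_rcos_sum)

lemma Q_mult: "f \<in> carrier F \<Longrightarrow> g \<in> carrier F \<Longrightarrow> proj f \<otimes>\<^bsub>Q\<^esub> proj g = proj (f \<otimes>\<^bsub>F\<^esub> g)"
  by (simp add: quot_algebra_def ring.extend_def FactRing_def N.rcoset_mult_add)

text \<open>Scalar multiplication by \<open>a\<close> is multiplication by the element \<open>a\<cdot>1\<close> of the algebra.\<close>

lemma N_smult: "a \<in> carrier K \<Longrightarrow> f \<in> N \<Longrightarrow> a \<odot>\<^bsub>F\<^esub> f \<in> N"
  using N.I_l_closed[of f "a \<odot>\<^bsub>F\<^esub> \<one>\<^bsub>F\<^esub>"] N.a_Hcarr[of f] by (simp add: F_smult_mult_left)

lemma proj_eqI: "g \<in> proj f \<Longrightarrow> f \<in> carrier F \<Longrightarrow> proj g = proj f"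
  using N.a_repr_independence' by metis

lemma proj_smult_eq:
  assumes "a \<in> carrier K" "f \<in> carrier F" "g \<in> proj f"
  shows "proj (a \<odot>\<^bsub>F\<^esub> g) = proj (a \<odot>\<^bsub>F\<^esub> f)"
proof -
  obtain h where h: "h \<in> N" "g = h \<oplus>\<^bsub>F\<^esub> f" using assms by (auto simp: a_r_coset_def')
  then have "a \<odot>\<^bsub>F\<^esub> g = a \<odot>\<^bsub>F\<^esub> h \<oplus>\<^bsub>F\<^esub> a \<odot>\<^bsub>F\<^esub> f"
    using assms N.a_Hcarr by (simp add: F.smult_r_distr)
  then have "a \<odot>\<^bsub>F\<^esub> g \<in> proj (a \<odot>\<^bsub>F\<^esub> f)"
    using N_smult[OF assms(1) h(1)] by (auto simp: a_r_coset_def')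
  then show ?thesis using assms by (intro proj_eqI) auto
qed

lemma Q_smult:
  assumes "a \<in> carrier K" "f \<in> carrier F"
  shows "a \<odot>\<^bsub>Q\<^esub> proj f = proj (a \<odot>\<^bsub>F\<^esub> f)"
proof -
  have "a \<odot>\<^bsub>Q\<^esub> proj f = (\<Union>g\<in>proj f. proj (a \<odot>\<^bsub>F\<^esub> g))"
    by (simp add: quot_algebra_def ring.extend_def module.fields_def)
  also have "\<dots> = proj (a \<odot>\<^bsub>F\<^esub> f)"
    using proj_smult_eq[OF assms] N.a_rcos_self[OF assms(2)] by blast
  finally show ?thesis .
qed

lemma proj_zero: "proj \<zero>\<^bsub>F\<^esub> = \<zero>\<^bsub>Q\<^esub>"
  using N.a_rcos_const[of "\<zero>\<^bsub>F\<^esub>"] by (simp add: Q_zero)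

lemma proj_eq_zero_iff: "f \<in> carrier F \<Longrightarrow> proj f = \<zero>\<^bsub>Q\<^esub> \<longleftrightarrow> f \<in> N"
  using N.a_rcos_self[of f] N.a_rcos_const[of f] by (auto simp: Q_zero)

lemma Q_module: "module K Q"
proof (intro moduleI is_cring)
  show "abelian_group Q"
  proof (rule abelian_groupI)
    fix x assume "x \<in> carrier Q"
    then obtain f where f: "x = proj f" "f \<in> carrier F" by (auto simp: Q_carrier)
    then show "\<exists>y\<in>carrier Q. y \<oplus>\<^bsub>Q\<^esub> x = \<zero>\<^bsub>Q\<^esub>"
      by (intro bexI[of _ "proj (\<ominus>\<^bsub>F\<^esub> f)"])
         (auto simp: Q_add F.l_neg proj_zero, auto simp: Q_carrier)
  next
    fix x y assume "x \<in> carrier Q" "y \<in> carrier Q"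
    then show "x \<oplus>\<^bsub>Q\<^esub> y = y \<oplus>\<^bsub>Q\<^esub> x"
      using F.a_comm by (auto simp: Q_carrier Q_add)
  qed (auto simp: Q_carrier Q_add F.a_assoc simp flip: proj_zero)
qed (auto simp: Q_carrier Q_add Q_smult F.smult_l_distr F.smult_r_distr F.smult_assoc1)

sublocale Q: module K Q by (rule Q_module)

lemma proj_finsum:
  assumes "finite Y" "h \<in> Y \<rightarrow> carrier F"
  shows "(\<Oplus>\<^bsub>Q\<^esub>y\<in>Y. proj (h y)) = proj (\<Oplus>\<^bsub>F\<^esub>y\<in>Y. h y)"
  using assms
proof (induction Y)
  case (insert y Y)
  then have "(\<lambda>y. proj (h y)) \<in> Y \<rightarrow> carrier Q" by (auto simp: Q_carrier)
  then show ?case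
    using insert by (auto simp: Q.finsum_insert F.finsum_insert Q_carrier Q_add Pi_def F.finsum_closed)
qed (simp add: proj_zero)

lemma word_prod_proj:
  "u \<in> lists I \<Longrightarrow> word_prod Q (\<lambda>i. proj (free_gen K i)) u = proj (monomial u)"
proof (induction u)
  case Nil
  then show ?case by (simp add: word_prod_def Q_one F_one)
next
  case (Cons i u)
  have "free_gen K i = monomial [i]" by (simp add: free_gen_def monomial_def)
  with Cons show ?case by (simp add: word_prod_def Q_mult monomial_mult)
qed

lemma proj_context:
  assumes "proj (monomial u) = proj (monomial v)"
    and "u \<in> lists I" "v \<in> lists I" "x \<in> lists I" "y \<in> lists I"
  shows "proj (monomial (x @ u @ y)) = proj (monomial (x @ v @ y))"
proof -
  have "proj (monomial (x @ u @ y)) = proj (monomial x) \<otimes>\<^bsub>Q\<^esub> (proj (monomial u) \<otimes>\<^bsub>Q\<^esub> proj (monomial y))"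
    if "u \<in> lists I" for u
    using that assms by (simp add: Q_mult monomial_mult)
  then show ?thesis using assms by metis
qed

lemma monomial_context_in_N:
  assumes "monomial u \<in> N" "u \<in> lists I" "x \<in> lists I" "y \<in> lists I"
  shows "monomial (x @ u @ y) \<in> N"
proof -
  have "monomial x \<otimes>\<^bsub>F\<^esub> (monomial u \<otimes>\<^bsub>F\<^esub> monomial y) \<in> N"
    using assms by (intro N.I_l_closed N.I_r_closed) auto
  then show ?thesis by (simp add: monomial_mult)
qed

lemma proj_eq_iff:
  assumes "f \<in> carrier F" "g \<in> carrier F"
  shows "proj f = proj g \<longleftrightarrow> f \<ominus>\<^bsub>F\<^esub> g \<in> N"
  using N.a_rcos_module_minus[OF F_ring assms(2,1)] assms
    N.a_rcos_self[OF assms(1)] proj_eqI by metis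

end

section \<open>The basis of the nil-Hecke algebra\<close>

locale nil_hecke_presentation = coxeter_system I m + free_algebra_over K I
  for K :: "('k, 'c) ring_scheme" (structure) and I :: "'i set" and m :: "'i \<Rightarrow> 'i \<Rightarrow> enat"
begin

abbreviation relators :: "'i set set \<Rightarrow> ('i list \<Rightarrow> 'k) set" where
  "relators \<equiv> nil_hecke_relators K I m (\<lambda>_. 2)"

abbreviation relation_ideal :: "'i set set \<Rightarrow> ('i list \<Rightarrow> 'k) set" where
  "relation_ideal \<equiv> nil_hecke_ideal K I m (\<lambda>_. 2)"

lemma relators_eq:
  "relators J = {monomial [i, i] | i. i \<in> I}
     \<union> {monomial (braid_word m a b) \<ominus>\<^bsub>F\<^esub> monomial (braid_word m b a) | a b. {a, b} \<in> J}
     \<union> {monomial (braid_word m a b) | a b. {a, b} \<in> braid_pairs I m - J}"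
proof -
  have "free_gen K i [^]\<^bsub>F\<^esub> (2 :: nat) = monomial [i, i]" if "i \<in> I" for i
  proof -
    have "free_gen K i = monomial [i]" by (simp add: free_gen_def monomial_def)
    then show ?thesis using that by (simp add: numeral_2_eq_2 monomial_mult)
  qed
  then have "{free_gen K i [^]\<^bsub>F\<^esub> (2 :: nat) | i. i \<in> I} = {monomial [i, i] | i. i \<in> I}" by force
  then show ?thesis
    unfolding nil_hecke_relators_def Let_def word_prod_free_gen by simp
qed

lemma relators_closed:
  assumes "J \<subseteq> braid_pairs I m" shows "relators J \<subseteq> carrier F"
proof -
  have "monomial (braid_word m a b) \<in> carrier F" "monomial (braid_word m b a) \<in> carrier F"
    if "{a, b} \<in> braid_pairs I m" for a b
    using that braid_word_in_lists[of a b] by auto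
  then show ?thesis unfolding relators_eq using assms by fastforce
qed

lemma relation_ideal_quotient:
  assumes "J \<subseteq> braid_pairs I m" shows "free_algebra_quotient K I (relation_ideal J)"
  unfolding nil_hecke_ideal_def
  by (intro free_algebra_quotient.intro F.genideal_ideal relators_closed assms
      free_algebra_over_axioms)

lemma relators_in_ideal: "J \<subseteq> braid_pairs I m \<Longrightarrow> relators J \<subseteq> relation_ideal J"
  unfolding nil_hecke_ideal_def by (intro F.genideal_self relators_closed)

lemma relation_ideal_subset:
  assumes J: "J \<subseteq> braid_pairs I m"
  shows "relation_ideal J \<subseteq> binomial_span (vanishing J) (braid_eq J)"
  unfolding nil_hecke_ideal_def
proof (rule F.genideal_minimal)
  show "ideal (binomial_span (vanishing J) (braid_eq J)) F"
    by (intro binomial_span_ideal vanishing_context braid_eq_context)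
  have word: "monomial u \<in> binomial_span (vanishing J) (braid_eq J)"
    if "u \<in> lists I" "vanishing J u" for u
    using binomial_span.word[of \<one> u "vanishing J" "braid_eq J"] that by simp
  have pair: "monomial u \<ominus>\<^bsub>F\<^esub> monomial v \<in> binomial_span (vanishing J) (braid_eq J)"
    if "u \<in> lists I" "v \<in> lists I" "braid_eq J u v" for u v
    using binomial_span.pair[of \<one> u v "braid_eq J" "vanishing J"] that
    by (simp add: F.smult_l_minus a_minus_def)
  have braid: "braid_eq J (braid_word m a b) (braid_word m b a)" if "{a, b} \<in> J" for a b
    using braid_move.intros[OF that, of "[]" "[]"] by simp
  show "relators J \<subseteq> binomial_span (vanishing J) (braid_eq J)"
    unfolding relators_eq
  proof (intro Un_least subsetI; clarify)
    fix i assume "i \<in> I"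
    then show "monomial [i, i] \<in> binomial_span (vanishing J) (braid_eq J)"
      by (intro word vanishing_square) auto
  next
    fix a b assume "{a, b} \<in> J"
    then show "monomial (braid_word m a b) \<ominus>\<^bsub>F\<^esub> monomial (braid_word m b a)
        \<in> binomial_span (vanishing J) (braid_eq J)"
      using J braid_word_in_lists[of a b] braid by (intro pair) blast+
  next
    fix a b assume "{a, b} \<in> braid_pairs I m" "{a, b} \<notin> J"
    then show "monomial (braid_word m a b) \<in> binomial_span (vanishing J) (braid_eq J)"
      using braid_word_in_lists[of a b] vanishing_braid_word[of a b J] by (intro word) blast+
  qed
qed

lemma proj_monomial_braid_eq:
  assumes J: "J \<subseteq> braid_pairs I m" and u: "u \<in> lists I" and "braid_eq J u v"
  shows "relation_ideal J +>\<^bsub>F\<^esub> monomial u = relation_ideal J +>\<^bsub>F\<^esub> monomial v"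
  using assms(3)
proof induction
  case (step v w)
  interpret free_algebra_quotient K I "relation_ideal J" by (rule relation_ideal_quotient[OF J])
  have l: "v \<in> lists I" using braid_eq_in_lists[OF step(1) J u] .
  from step(2) have "proj (monomial v) = proj (monomial w)"
  proof cases
    case (1 a b x y)
    have bw: "braid_word m a b \<in> lists I" "braid_word m b a \<in> lists I"
      using 1 J braid_word_in_lists[of a b] by auto
    have "monomial (braid_word m a b) \<ominus>\<^bsub>F\<^esub> monomial (braid_word m b a) \<in> relation_ideal J"
      using relators_in_ideal[OF J] 1 unfolding relators_eq by blast
    then have "proj (monomial (braid_word m a b)) = proj (monomial (braid_word m b a))"
      using bw by (simp add: proj_eq_iff)
    then show ?thesis using l bw unfolding 1 by (intro proj_context) auto
  qed
  with step.IH show ?case by simp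
qed simp

lemma vanishing_in_relation_ideal:
  assumes J: "J \<subseteq> braid_pairs I m" and u: "u \<in> lists I" and "vanishing J u"
  shows "monomial u \<in> relation_ideal J"
proof -
  interpret free_algebra_quotient K I "relation_ideal J" by (rule relation_ideal_quotient[OF J])
  from assms(3) obtain x y z where xyz: "braid_eq J u (x @ z @ y)"
    and z: "(\<exists>i. z = [i, i]) \<or> (\<exists>a b. {a, b} \<in> braid_pairs I m - J \<and> z = braid_word m a b)"
    unfolding vanishing_def by blast
  have l: "x @ z @ y \<in> lists I" using braid_eq_in_lists[OF xyz J u] .
  have "monomial z \<in> relators J"
    using z
  proof
    assume "\<exists>i. z = [i, i]"
    then show ?thesis using l unfolding relators_eq by auto
  qed (unfold relators_eq, blast)
  then have "monomial z \<in> relation_ideal J" using relators_in_ideal[OF J] by blast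
  then have "monomial (x @ z @ y) \<in> relation_ideal J"
    using l by (intro monomial_context_in_N) auto
  then show ?thesis
    using proj_monomial_braid_eq[OF J u xyz] proj_eq_zero_iff u l by (metis monomial_closed)
qed

text \<open>This is the reason why the natural surjection exists: the braid relation of a pair outside
  \<open>J\<close> still holds because both of its sides become zero.\<close>

lemma relation_ideal_antimono:
  assumes "J \<subseteq> braid_pairs I m"
  shows "relation_ideal (braid_pairs I m) \<subseteq> relation_ideal J"
proof -
  interpret free_algebra_quotient K I "relation_ideal J" by (rule relation_ideal_quotient[OF assms])
  have "monomial (braid_word m a b) \<ominus>\<^bsub>F\<^esub> monomial (braid_word m b a) \<in> relation_ideal J"
    if ab: "{a, b} \<in> braid_pairs I m" for a b
  proof -
    have bw: "braid_word m a b \<in> lists I" "braid_word m b a \<in> lists I"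
      using ab by (rule braid_word_in_lists)+
    have "proj (monomial (braid_word m a b)) = proj (monomial (braid_word m b a))"
    proof (cases "{a, b} \<in> J")
      case True
      then have "braid_eq J (braid_word m a b) (braid_word m b a)"
        using braid_move.intros[of a b J "[]" "[]"] by simp
      then show ?thesis using proj_monomial_braid_eq assms bw by blast
    next
      case False
      then have "vanishing J (braid_word m a b)" "vanishing J (braid_word m b a)"
        using ab vanishing_braid_word[of a b J] vanishing_braid_word[of b a J]
        by (auto simp: insert_commute)
      then have "monomial (braid_word m a b) \<in> relation_ideal J"
          "monomial (braid_word m b a) \<in> relation_ideal J"
        using vanishing_in_relation_ideal assms bw by auto
      then show ?thesis using bw by (metis proj_eq_zero_iff monomial_closed)
    qed
    then show ?thesis using bw by (simp add: proj_eq_iff)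
  qed
  moreover have "monomial [i, i] \<in> relation_ideal J" if "i \<in> I" for i
    using that assms vanishing_square by (intro vanishing_in_relation_ideal) auto
  ultimately have "relators (braid_pairs I m) \<subseteq> relation_ideal J"
    unfolding relators_eq by auto
  then show ?thesis
    unfolding nil_hecke_ideal_def[of K I m _ "braid_pairs I m"]
    by (intro F.genideal_minimal N.is_ideal)
qed

text \<open>By Matsumoto's theorem the products along all reduced expressions of an element agree, so
  the definite description in the canonical basis is satisfied.\<close>

lemma nil_coxeter_basis_eq:
  assumes u: "reduced u"
  shows "nil_coxeter_basis K I m (elem u) = relation_ideal (braid_pairs I m) +>\<^bsub>F\<^esub> monomial u"
proof -
  interpret free_algebra_quotient K I "relation_ideal (braid_pairs I m)" by (rule relation_ideal_quotient) simp
  have wp: "word_prod (nil_coxeter K I m) (nil_hecke_gen K I m (\<lambda>_. 2) (braid_pairs I m)) v =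
      proj (monomial v)" if "v \<in> lists I" for v
    using word_prod_proj[OF that]
    unfolding nil_coxeter_def nil_hecke_def nil_hecke_gen_def[abs_def] .
  have eq: "proj (monomial u) = proj (monomial v)" if "reduced v" "elem u = elem v" for v
  proof -
    have "u \<approx> v" using that u elem_eq_iff reduced_in_lists by blast
    then show ?thesis
      using matsumoto u that reduced_in_lists by (intro proj_monomial_braid_eq) auto
  qed
  show ?thesis
    unfolding nil_coxeter_basis_def reduced_expr_iff
  proof (rule the_equality)
    show "\<forall>v. reduced v \<and> elem u = elem v \<longrightarrow> proj (monomial u) =
        word_prod (nil_coxeter K I m) (nil_hecke_gen K I m (\<lambda>_. 2) (braid_pairs I m)) v"
      using eq wp reduced_in_lists by metis
    show "x = proj (monomial u)" if "\<forall>v. reduced v \<and> elem u = elem v \<longrightarrow>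
        x = word_prod (nil_coxeter K I m) (nil_hecke_gen K I m (\<lambda>_. 2) (braid_pairs I m)) v" for x
      using that u wp[OF reduced_in_lists[OF u]] by simp
  qed
qed

lemma nil_hecke_proj_basis:
  assumes u: "reduced u" and J: "J \<subseteq> braid_pairs I m"
  shows "nil_hecke_proj K I m J (nil_coxeter_basis K I m (elem u)) = relation_ideal J +>\<^bsub>F\<^esub> monomial u"
proof -
  interpret P: free_algebra_quotient K I "relation_ideal (braid_pairs I m)" by (rule relation_ideal_quotient) simp
  interpret free_algebra_quotient K I "relation_ideal J" by (rule relation_ideal_quotient[OF J])
  have mu: "monomial u \<in> carrier F" using u reduced_in_lists by simp
  have "proj f = proj (monomial u)" if "f \<in> P.proj (monomial u)" for f
  proof (rule proj_eqI[OF _ mu])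
    show "f \<in> proj (monomial u)"
      using that relation_ideal_antimono[OF J] by (auto simp: a_r_coset_def')
  qed
  then show ?thesis
    unfolding nil_hecke_proj_def nil_coxeter_basis_eq[OF u]
    using P.N.a_rcos_self[OF mu] by blast
qed

text \<open>Monomials of vanishing words are zero in the quotient, and every other word is a reduced
  expression of an element of \<open>W(J)\<close>; hence the family spans. For independence, the reduced
  expressions of \<open>x \<in> W(J)\<close> form a class on which \<open>coeff_sum\<close> reads off the coefficient of \<open>x\<close>.\<close>

theorem nil_hecke_basis:
  assumes fin: "finite I" and J: "J \<subseteq> braid_pairs I m"
  shows "module_basis K (nil_hecke K I m (\<lambda>_. 2) J) (W_sub I m J)
           (\<lambda>w. nil_hecke_proj K I m J (nil_coxeter_basis K I m w))"
proof -
  interpret free_algebra_quotient K I "relation_ideal J" by (rule relation_ideal_quotient[OF J])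
  let ?X = "W_sub I m J"
  define b where "b = (\<lambda>w. nil_hecke_proj K I m J (nil_coxeter_basis K I m w))"
  define r where "r w = (SOME u. reduced u \<and> w = elem u)" for w
  have r: "reduced (r w) \<and> w = elem (r w)" if "w \<in> ?X" for w
  proof -
    have "w \<in> carrier (coxeter_group I m)" using that unfolding W_sub_def by blast
    then obtain u where "reduced u" "w = elem u" by (rule ex_reduced_expr)
    then have "\<exists>u. reduced u \<and> w = elem u" by blast
    then show ?thesis unfolding r_def by (rule someI_ex)
  qed
  have rl: "monomial (r w) \<in> carrier F" if "w \<in> ?X" for w
    using r[OF that] reduced_in_lists by simp
  have b: "b w = proj (monomial (r w))" if "w \<in> ?X" for w
    using r[OF that] nil_hecke_proj_basis[OF _ J] unfolding b_def by metis
  have b_carrier: "b \<in> ?X \<rightarrow> carrier Q"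
    using b rl by (auto simp: Q_carrier)

  have span: "\<exists>Y c. finite Y \<and> Y \<subseteq> ?X \<and> c \<in> Y \<rightarrow> carrier K \<and>
      proj f = (\<Oplus>\<^bsub>Q\<^esub>x\<in>Y. c x \<odot>\<^bsub>Q\<^esub> b x)" if "f \<in> carrier F" for f
    using that
  proof (induction rule: free_algebra_induct)
    case zero
    show ?case by (intro exI[of _ "{}"]) (simp add: proj_zero)
  next
    case (add a u f)
    then obtain Y c where Y: "finite Y" "Y \<subseteq> ?X" "c \<in> Y \<rightarrow> carrier K"
      "proj f = (\<Oplus>\<^bsub>Q\<^esub>x\<in>Y. c x \<odot>\<^bsub>Q\<^esub> b x)" by blast
    have mu: "monomial u \<in> carrier F" using add by simp
    have split: "proj (a \<odot>\<^bsub>F\<^esub> monomial u \<oplus>\<^bsub>F\<^esub> f) = a \<odot>\<^bsub>Q\<^esub> proj (monomial u) \<oplus>\<^bsub>Q\<^esub> proj f"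
      using add mu by (simp add: Q_add Q_smult)
    show ?case
    proof (cases "vanishing J u")
      case True
      then have "proj (monomial u) = \<zero>\<^bsub>Q\<^esub>"
        using vanishing_in_relation_ideal[OF J] add mu proj_eq_zero_iff by blast
      then have eq: "proj (a \<odot>\<^bsub>F\<^esub> monomial u \<oplus>\<^bsub>F\<^esub> f) = proj f"
        unfolding split using add by (auto simp: Q_carrier)
      show ?thesis unfolding eq by (rule add.IH)
    next
      case False
      then have u: "reduced u" using add reduced_if_not_vanishing by blast
      then have X: "elem u \<in> ?X" using False elem_in_W_sub_iff[OF _ J] by blast
      have "proj (monomial u) = b (elem u)"
        unfolding b_def nil_hecke_proj_basis[OF u J] ..
      then show ?thesis
        unfolding split Y(4)
        using Q.linear_combination_add[OF b_carrier X add(1) Y(1-3)] by simp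
    qed
  qed

  have indep: "c x = \<zero>" if Y: "finite Y" "Y \<subseteq> ?X" "c \<in> Y \<rightarrow> carrier K"
    and sum: "(\<Oplus>\<^bsub>Q\<^esub>x\<in>Y. c x \<odot>\<^bsub>Q\<^esub> b x) = \<zero>\<^bsub>Q\<^esub>" and x: "x \<in> Y" for Y c x
  proof -
    define h where "h y = c y \<odot>\<^bsub>F\<^esub> monomial (r y)" for y
    have h: "h \<in> Y \<rightarrow> carrier F" using Y rl by (auto simp: h_def Pi_def)
    have "(\<Oplus>\<^bsub>Q\<^esub>x\<in>Y. c x \<odot>\<^bsub>Q\<^esub> b x) = (\<Oplus>\<^bsub>Q\<^esub>y\<in>Y. proj (h y))"
    proof (rule Q.finsum_cong')
      show "(\<lambda>y. proj (h y)) \<in> Y \<rightarrow> carrier Q" using h by (auto simp: Q_carrier)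
      show "c y \<odot>\<^bsub>Q\<^esub> b y = proj (h y)" if "y \<in> Y" for y
        using Y rl b that by (auto simp: h_def Q_smult Pi_def subset_iff)
    qed simp
    then have N: "(\<Oplus>\<^bsub>F\<^esub>y\<in>Y. h y) \<in> relation_ideal J"
      using sum proj_finsum[OF Y(1) h] proj_eq_zero_iff[OF F.finsum_closed[OF h]] by simp
    define C where "C = {u. reduced u \<and> elem u = x}"
    have finC: "finite C" unfolding C_def by (rule finite_reduced_exprs[OF fin])
    have disj: "u \<notin> C" if "vanishing J u" for u
      using that x Y elem_in_W_sub_iff[OF _ J] unfolding C_def by blast
    have inv: "u \<in> C \<longleftrightarrow> v \<in> C" if "braid_eq J u v" for u v
    proof -
      have *: "v \<in> C" if "u \<in> C" "braid_eq J u v" for u v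
        using that reduced_braid_eq[OF _ that(2) J] unfolding C_def by blast
      show ?thesis using * that braid_eq_sym by blast
    qed
    have "coeff_sum C (\<Oplus>\<^bsub>F\<^esub>y\<in>Y. h y) = \<zero>"
      by (rule coeff_sum_binomial_span[OF subsetD[OF relation_ideal_subset[OF J] N] finC disj inv])
    then have "\<zero> = coeff_sum C (\<Oplus>\<^bsub>F\<^esub>y\<in>Y. h y)" ..
    also have "\<dots> = (\<Oplus>y\<in>Y. coeff_sum C (h y))"
      using Y(1) h
    proof (induction Y)
      case (insert y Y)
      then show ?case
        by (auto simp: F.finsum_insert finsum_insert coeff_sum_add Pi_def F.finsum_closed)
    qed (simp add: coeff_sum_zero)
    also have "\<dots> = (\<Oplus>y\<in>Y. if x = y then c y else \<zero>)"
    proof (rule finsum_cong')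
      show "(\<lambda>y. if x = y then c y else \<zero>) \<in> Y \<rightarrow> carrier K" using Y by auto
      fix y assume y: "y \<in> Y"
      then have "reduced (r y)" "elem (r y) = y" using r[of y] Y by auto
      then show "coeff_sum C (h y) = (if x = y then c y else \<zero>)"
        unfolding h_def using finC Y y by (subst coeff_sum_smult_monomial) (auto simp: C_def)
    qed simp
    also have "\<dots> = c x" using finsum_singleton[OF x Y(1), of c] Y(3) by simp
    finally show ?thesis ..
  qed

  show ?thesis
    unfolding module_basis_def nil_hecke_def b_def[symmetric]
    using Q_module b_carrier span indep by (auto simp: Q_carrier)
qed

end

theorem theorem2p3:
  fixes K :: "('k, 'c) ring_scheme"
    and I :: "'i set"
    and m :: "'i \<Rightarrow> 'i \<Rightarrow> enat"
    and J0 :: "'i set set"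
  assumes "cring K"
    and "finite I"
    and "coxeter_matrix I m"
    and "J0 \<subseteq> braid_pairs I m"
  shows "module_basis K (nil_hecke K I m (\<lambda>_. 2) J0) (W_sub I m J0)
           (\<lambda>w. nil_hecke_proj K I m J0 (nil_coxeter_basis K I m w))"
proof -
  interpret nil_hecke_presentation K I m
    using assms by (intro nil_hecke_presentation.intro coxeter_system.intro free_algebra_over.intro)
  show ?thesis using assms by (intro nil_hecke_basis)
qed

end
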